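(* For all nonnegative integers $a_1,\dots,a_n$, \[F(a_2,\dots,a_n)=\sum_{M}\prod_{i=1}^{n-1}B(m_{i,i+1})\prod_{j>i+1}A(m_{ij}),\] where the sum is over all Tesler matrices $M=(m_{ij})$ associated to $(a_1,\dots,a_n)$.
   Context: Let $q,t$ be indeterminates. A standard Young tableau $T$ with $n$ boxes is a bijective filling of the Young diagram of a partition of $n$ by $1,\dots,n$, increasing along rows (left to right) and columns (bottom to top); rows $r$ counted from the bottom, columns $c$ from the left, starting at $1$. Let $z_i=q^{c-1}t^{r-1}$ where $i$ sits in row $r$, column $c$. Define \[\mathrm{wt}(T)=\prod_{i=2}^{n}\frac{1}{(1-z_i^{-1})(1-qtz_{i-1}/z_i)}\prod_{1\leqslant i<j\leqslant n}\frac{(1-z_i/z_j)(1-qtz_i/z_j)}{(1-qz_i/z_j)(1-tz_i/z_j)},\] omitting any individual factor that vanishes, and $F(a_2,\dots,a_n)=\sum_T z_2^{a_2}\cdots z_n^{a_n}\mathrm{wt}(T)$ over all standard Young tableaux with $n$ boxes. A Tesler matrix associated to $(a_1,\dots,a_n)$ is an upper-triangular matrix $(m_{ij})_{1\leqslant i\leqslant j\leqslant n}$ with nonnegative integer entries satisfying $m_{ii}+\sum_{j<i}m_{ji}-\sum_{j>i}m_{ij}=a_i$ for all $i$. With $[m]_{q,t}=q^{m-1}+q^{m-2}t+\cdots+t^{m-1}$ (and $[0]_{q,t}=0$), the coefficients $A(m),B(m)$ are defined by \[\sum_{m\geqslant0}A(m)z^m=\frac{(1-z)(1-qtz)}{(1-qz)(1-tz)},\qquad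 \sum_{m\geqslant 0}B(m)z^m=\frac{1-z}{(1-qz)(1-tz)},\] i.e. $A(0)=1$, $A(m)=-(1-q)(1-t)[m]_{q,t}$ for $m\geqslant1$, and $B(m)=[m+1]_{q,t}-[m]_{q,t}$. *)

theory Defs
  imports
    "HOL-Computational_Algebra.Computational_Algebra"
    "HOL-Library.FuncSet"
begin

text \<open>
  The field of rational functions over the rationals in two independent indeterminates:
  \<open>t_var\<close> is the outer polynomial variable and \<open>q_var\<close> the inner one.
\<close>

type_synonym qt_field = "rat poly poly fract"

definition q_var :: qt_field where
  "q_var = to_fract [:[:0, 1:]:]"

definition t_var :: qt_field where
  "t_var = to_fract [:0, 1:]"

definition is_partition :: "nat \<Rightarrow> nat list \<Rightarrow> bool" where
  "is_partition n lam \<longleftrightarrow> sorted_wrt (\<ge>) lam \<and> 0 \<notin> set lam \<and> sum_list lam = n"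

text \<open>
  A box is a pair (row, column), both counted from 1; row 1 is the bottom row and has
  length \<open>lam ! 0\<close>, the largest part.
\<close>

definition young_diagram :: "nat list \<Rightarrow> (nat \<times> nat) set" where
  "young_diagram lam = {(r, c). 1 \<le> r \<and> r \<le> length lam \<and> 1 \<le> c \<and> c \<le> lam ! (r - 1)}"

text \<open>
  A standard Young tableau is a shape together with a filling of it. Fillings are required
  to be \<open>extensional\<close>, so that each tableau is represented exactly once.
\<close>

definition standard_young_tableaux :: "nat \<Rightarrow> (nat list \<times> (nat \<times> nat \<Rightarrow> nat)) set" where
  "standard_young_tableaux n = {(lam, T).
     is_partition n lam \<and>
     T \<in> extensional (young_diagram lam) \<and>
     bij_betw T (young_diagram lam) {1..n} \<and>
     (\<forall>r c c'. (r, c) \<in> young_diagram lam \<and> (r, c') \<in> young_diagram lam \<and> c < c'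
        \<longrightarrow> T (r, c) < T (r, c')) \<and>
     (\<forall>r r' c. (r, c) \<in> young_diagram lam \<and> (r', c) \<in> young_diagram lam \<and> r < r'
        \<longrightarrow> T (r, c) < T (r', c))}"

definition box_weight ::
    "'a::field \<Rightarrow> 'a \<Rightarrow> nat list \<times> (nat \<times> nat \<Rightarrow> nat) \<Rightarrow> nat \<Rightarrow> 'a" where
  "box_weight q t = (\<lambda>(lam, T) i.
     case inv_into (young_diagram lam) T i of (r, c) \<Rightarrow> q ^ (c - 1) * t ^ (r - 1))"

text \<open>Applied to every individual factor of the weight: a factor that vanishes is omitted.\<close>

definition omit0 :: "'a::field \<Rightarrow> 'a" where
  "omit0 x = (if x = 0 then 1 else x)"

definition tableau_weight ::
    "'a::field \<Rightarrow> 'a \<Rightarrow> nat \<Rightarrow> nat list \<times> (nat \<times> nat \<Rightarrow> nat) \<Rightarrow> 'a" where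
  "tableau_weight q t n T = (let z = box_weight q t T in
     (\<Prod>i=2..n. 1 / (omit0 (1 - inverse (z i)) * omit0 (1 - q * t * z (i - 1) / z i))) *
     (\<Prod>(i, j)\<in>{(i, j). 1 \<le> i \<and> i < j \<and> j \<le> n}.
        (omit0 (1 - z i / z j) * omit0 (1 - q * t * z i / z j)) /
        (omit0 (1 - q * z i / z j) * omit0 (1 - t * z i / z j))))"

definition tableau_sum :: "'a::field \<Rightarrow> 'a \<Rightarrow> nat \<Rightarrow> (nat \<Rightarrow> nat) \<Rightarrow> 'a" where
  "tableau_sum q t n a =
     (\<Sum>T\<in>standard_young_tableaux n.
        (\<Prod>i=2..n. box_weight q t T i ^ a i) * tableau_weight q t n T)"

text \<open>
  Matrices are functions of two indices that vanish off the triangle \<open>1 \<le> i \<le> j \<le> n\<close>, so that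
  each matrix is represented exactly once. The sign convention (incoming entries \<open>m j i\<close>
  are added, outgoing entries \<open>m i j\<close> subtracted) is the reverse of the one often used
  for Tesler matrices.
\<close>

definition tesler_matrices :: "nat \<Rightarrow> (nat \<Rightarrow> nat) \<Rightarrow> (nat \<Rightarrow> nat \<Rightarrow> nat) set" where
  "tesler_matrices n a = {m.
     (\<forall>i j. \<not> (1 \<le> i \<and> i \<le> j \<and> j \<le> n) \<longrightarrow> m i j = 0) \<and>
     (\<forall>i\<in>{1..n}. int (m i i) + (\<Sum>j\<in>{1..<i}. int (m j i)) - (\<Sum>j\<in>{i<..n}. int (m i j))
        = int (a i))}"

definition coeff_A :: "'a::field \<Rightarrow> 'a \<Rightarrow> nat \<Rightarrow> 'a" where
  "coeff_A q t m = fps_nth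
     ((1 - fps_X) * (1 - fps_const (q * t) * fps_X) /
      ((1 - fps_const q * fps_X) * (1 - fps_const t * fps_X))) m"

definition coeff_B :: "'a::field \<Rightarrow> 'a \<Rightarrow> nat \<Rightarrow> 'a" where
  "coeff_B q t m = fps_nth
     ((1 - fps_X) / ((1 - fps_const q * fps_X) * (1 - fps_const t * fps_X))) m"

text \<open>
  The explicit form of the coefficients, with \<open>qt_number q t m\<close> the sum of all monomials
  of degree \<open>m - 1\<close> in \<open>q\<close> and \<open>t\<close>.
\<close>

definition qt_number :: "'a::field \<Rightarrow> 'a \<Rightarrow> nat \<Rightarrow> 'a" where
  "qt_number q t m = (\<Sum>k<m. q ^ (m - 1 - k) * t ^ k)"

lemma qt_number_0: "qt_number q t 0 = 0"
  by (simp add: qt_number_def)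

lemma qt_number_Suc: "qt_number q t (Suc m) = q * qt_number q t m + t ^ m"
proof -
  have "(\<Sum>k<m. q ^ (m - k) * t ^ k) = (\<Sum>k<m. q * (q ^ (m - 1 - k) * t ^ k))"
    by (rule sum.cong) (auto simp flip: power_Suc mult.assoc simp: Suc_diff_Suc)
  then show ?thesis
    by (simp add: qt_number_def sum_distrib_left)
qed

lemma fps_nth_linear_factor_mult:
  fixes c :: "'a::field"
  shows "fps_nth ((1 - fps_const c * fps_X) * h) k =
    fps_nth h k - (if k = 0 then 0 else c * fps_nth h (k - 1))"
  by (simp add: left_diff_distrib mult.assoc)

lemma fps_quotient_eqI:
  fixes f h :: "'a::field fps"
  assumes "(1 - fps_const q * fps_X) * ((1 - fps_const t * fps_X) * h) = f"
  shows "f / ((1 - fps_const q * fps_X) * (1 - fps_const t * fps_X)) = h"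
proof -
  have "fps_nth ((1 - fps_const q * fps_X) * (1 - fps_const t * fps_X)) 0 \<noteq> 0"
    by simp
  then have "(1 - fps_const q * fps_X) * (1 - fps_const t * fps_X) \<noteq> 0"
    by (metis fps_zero_nth)
  then show ?thesis
    using assms by (metis mult.assoc nonzero_mult_div_cancel_left)
qed

lemma coeff_B_eq: "coeff_B q t m = qt_number q t (m + 1) - qt_number q t m"
proof -
  let ?h = "Abs_fps (\<lambda>m. qt_number q t (m + 1) - qt_number q t m)"
  have "(1 - fps_const q * fps_X) * ((1 - fps_const t * fps_X) * ?h) = 1 - fps_X"
  proof (rule fps_ext)
    fix k
    consider "k = 0" | "k = 1" | l where "k = Suc (Suc l)"
      by (metis One_nat_def nat.exhaust)
    then show "fps_nth ((1 - fps_const q * fps_X) * ((1 - fps_const t * fps_X) * ?h)) k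
        = fps_nth (1 - fps_X) k"
      unfolding fps_nth_linear_factor_mult
      by cases (simp_all add: qt_number_Suc qt_number_0 algebra_simps)
  qed
  then have "(1 - fps_X) / ((1 - fps_const q * fps_X) * (1 - fps_const t * fps_X)) = ?h"
    by (rule fps_quotient_eqI)
  then show ?thesis
    by (simp add: coeff_B_def)
qed

lemma coeff_A_eq:
  "coeff_A q t m = (if m = 0 then 1 else - ((1 - q) * (1 - t) * qt_number q t m))"
proof -
  let ?h = "Abs_fps (\<lambda>m. if m = 0 then 1 else - ((1 - q) * (1 - t) * qt_number q t m))"
  have "(1 - fps_const q * fps_X) * ((1 - fps_const t * fps_X) * ?h)
      = (1 - fps_X) * (1 - fps_const (q * t) * fps_X)"
  proof (rule fps_ext)
    fix k
    have eq: "(1 - fps_X) * (1 - fps_const (q * t) * fps_X)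
        = (1 - fps_const (q * t) * fps_X) * (1 - fps_X)"
      by (rule mult.commute)
    consider "k = 0" | "k = 1" | "k = 2" | l where "k = Suc (Suc (Suc l))"
      by (metis One_nat_def numeral_2_eq_2 nat.exhaust)
    then show "fps_nth ((1 - fps_const q * fps_X) * ((1 - fps_const t * fps_X) * ?h)) k
        = fps_nth ((1 - fps_X) * (1 - fps_const (q * t) * fps_X)) k"
      unfolding eq fps_nth_linear_factor_mult
      by cases (simp_all add: qt_number_Suc qt_number_0 numeral_2_eq_2 algebra_simps)
  qed
  then have "(1 - fps_X) * (1 - fps_const (q * t) * fps_X) /
      ((1 - fps_const q * fps_X) * (1 - fps_const t * fps_X)) = ?h"
    by (rule fps_quotient_eqI)
  then show ?thesis
    by (simp add: coeff_A_def)
qed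

text \<open>Both index sets are finite, so the sums over them are the intended ones.\<close>

lemma finite_young_diagram: "finite (young_diagram lam)"
proof -
  have "young_diagram lam \<subseteq> (\<Union>r\<in>{1..length lam}. {r} \<times> {1..lam ! (r - 1)})"
    by (auto simp: young_diagram_def)
  then show ?thesis
    by (rule finite_subset) auto
qed

lemma finite_partitions: "finite {lam. is_partition n lam}"
proof (rule finite_subset)
  show "{lam. is_partition n lam} \<subseteq> {lam. set lam \<subseteq> {..n} \<and> length lam \<le> n}"
  proof clarify
    fix lam assume *: "is_partition n lam"
    have "length lam \<le> sum_list lam"  if "0 \<notin> set lam" for lam :: "nat list"
      using that by (induction lam) auto
    moreover have "set lam \<subseteq> {..n}"
      using * member_le_sum_list by (auto simp: is_partition_def)
    ultimately show "set lam \<subseteq> {..n} \<and> length lam \<le> n"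
      using * by (auto simp: is_partition_def)
  qed
qed (simp add: finite_lists_length_le)

lemma finite_standard_young_tableaux: "finite (standard_young_tableaux n)"
proof (rule finite_subset)
  show "standard_young_tableaux n \<subseteq>
      (SIGMA lam:{lam. is_partition n lam}. young_diagram lam \<rightarrow>\<^sub>E {1..n})"
    by (auto simp: standard_young_tableaux_def PiE_def bij_betw_def)
  show "finite (SIGMA lam:{lam. is_partition n lam}. young_diagram lam \<rightarrow>\<^sub>E {1..n})"
    by (intro finite_SigmaI finite_partitions finite_PiE finite_young_diagram) auto
qed

lemma tesler_matrix_column_bounded: "\<exists>b. \<forall>m\<in>tesler_matrices n a. \<forall>j. m j i \<le> b"
proof (induction "n - i" arbitrary: i rule: less_induct)
  case less
  show ?case
  proof (cases "1 \<le> i \<and> i \<le> n")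
    case False
    then have "\<forall>m\<in>tesler_matrices n a. \<forall>j. m j i \<le> 0"
      by (auto simp: tesler_matrices_def)
    then show ?thesis by blast
  next
    case True
    have "\<forall>k\<in>{i<..n}. \<exists>b. \<forall>m\<in>tesler_matrices n a. \<forall>j. m j k \<le> b"
      using less True by auto
    then obtain b where b: "\<And>k m j. k \<in> {i<..n} \<Longrightarrow> m \<in> tesler_matrices n a \<Longrightarrow> m j k \<le> b k"
      unfolding bchoice_iff by blast
    have "m j i \<le> a i + (\<Sum>k\<in>{i<..n}. b k)" if m: "m \<in> tesler_matrices n a" for m j
    proof -
      have "int (m i i) + (\<Sum>j\<in>{1..<i}. int (m j i)) - (\<Sum>j\<in>{i<..n}. int (m i j)) = int (a i)"
        using m True by (auto simp: tesler_matrices_def)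
      then have "int (m i i + (\<Sum>j\<in>{1..<i}. m j i)) = int (a i + (\<Sum>k\<in>{i<..n}. m i k))"
        unfolding of_nat_add of_nat_sum by linarith
      then have "m i i + (\<Sum>j\<in>{1..<i}. m j i) = a i + (\<Sum>k\<in>{i<..n}. m i k)"
        by (rule of_nat_eq_iff[THEN iffD1])
      moreover have "(\<Sum>k\<in>{i<..n}. m i k) \<le> (\<Sum>k\<in>{i<..n}. b k)"
        using b m by (intro sum_mono) auto
      moreover have "m j i \<le> m i i + (\<Sum>j\<in>{1..<i}. m j i)"
      proof (cases "j \<in> {1..<i}")
        case True
        then have "m j i \<le> (\<Sum>j\<in>{1..<i}. m j i)"
          by (intro member_le_sum) auto
        then show ?thesis by simp
      next
        case False
        then have "j = i \<or> \<not> (1 \<le> j \<and> j \<le> i \<and> i \<le> n)"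
          by auto
        moreover have "\<not> (1 \<le> j \<and> j \<le> i \<and> i \<le> n) \<longrightarrow> m j i = 0"
          using m unfolding tesler_matrices_def by simp
        ultimately have "j = i \<or> m j i = 0"
          by argo
        then show ?thesis by auto
      qed
      ultimately show ?thesis by linarith
    qed
    then show ?thesis by blast
  qed
qed

lemma finite_tesler_matrices: "finite (tesler_matrices n a)"
proof -
  obtain b where b: "\<And>m i j. m \<in> tesler_matrices n a \<Longrightarrow> m j i \<le> b i"
    using tesler_matrix_column_bounded by metis
  let ?I = "{1..n} \<times> {1..n}"
  let ?f = "\<lambda>m. restrict (\<lambda>(i, j). m i j) ?I"
  have "?f ` tesler_matrices n a \<subseteq> (\<Pi>\<^sub>E (i, j)\<in>?I. {..b j})"
    using b by (auto simp: PiE_def)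
  moreover have "finite (\<Pi>\<^sub>E (i, j)\<in>?I. {..b j})"
    by (intro finite_PiE) auto
  ultimately have "finite (?f ` tesler_matrices n a)"
    by (rule finite_subset)
  moreover have "inj_on ?f (tesler_matrices n a)"
  proof (intro inj_onI ext)
    fix m m' i j
    assume m: "m \<in> tesler_matrices n a" "m' \<in> tesler_matrices n a" and eq: "?f m = ?f m'"
    show "m i j = m' i j"
    proof (cases "(i, j) \<in> ?I")
      case True
      then show ?thesis
        using fun_cong[OF eq, of "(i, j)"] by simp
    next
      case False
      then have "\<not> (1 \<le> i \<and> i \<le> j \<and> j \<le> n)"
        by auto
      then have "m i j = 0" "m' i j = 0"
        using m unfolding tesler_matrices_def by blast+
      then show ?thesis by simp
    qed
  qed
  ultimately show ?thesis
    by (rule finite_imageD)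
qed

end

theory Submission
  imports Defs
begin

text \<open>
  The Tesler sum is evaluated column by column. With columns \<open>1, \<dots>, k\<close> summed out, the remaining
  sum is evaluated at the box monomials \<open>z\<^sub>1, \<dots>, z\<^sub>k\<close> of a standard Young tableau with \<open>k\<close> boxes,
  and summing over column \<open>k + 1\<close> extracts a coefficient of the power series
  \<open>B(z\<^sub>k x) (\<Prod>i<k. A(z\<^sub>i x)) / (1 - x)\<close>. All linear factors of this rational function cancel
  except for a simple pole \<open>1 - w x\<close> for each addable box with monomial \<open>w\<close> and a zero
  \<open>1 - q t z x\<close> for each removable box other than the last one, with monomial \<open>z\<close>. Its partial
  fraction expansion is therefore a sum over the ways to add a box to the tableau, and the
  coefficients are the ratios of tableau weights.
\<close>

subsection \<open>Corners of Young diagrams\<close>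

text \<open>The cancellation comes from an inclusion-exclusion identity. If [X] is the sum of
  x^(c-1) y^(r-1) over the boxes (r, c) in X, then (1-x)(1-y)[S] = 1 - [addable corners] + xy
  [removable corners] for every finite diagram S. As a multiset equation it yields a product
  identity for any map into a commutative monoid, and it is used twice: with 1 - c x as a power
  series it produces the cancellation, and with \<open>omit0\<close> (1 - c/w) it identifies the
  coefficient at the pole 1/w with a ratio of tableau weights. Omitting vanishing factors is thus
  compatible with the cancellation, and no limit of a quotient 0/0 is ever taken. The last box is
  exceptional because its entry in the next column lies on the superdiagonal, where B lacks the
  numerator factor 1 - qtz of A. The induction closes because a simple pole contributes a multiple
  of w^p: the exponent p is \<open>a (k + 1)\<close> plus the later entries of row k + 1, so w
  becomes the variable attached to that row. The only genericity needed is that the monomials q^i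
  t^j are pairwise distinct.\<close>

definition diagram :: "(nat \<times> nat) set \<Rightarrow> bool" where
  "diagram S \<longleftrightarrow>
     (\<forall>r c. (r, c) \<in> S \<longrightarrow> 0 < r \<and> 0 < c) \<and>
     (\<forall>r c. (Suc r, c) \<in> S \<longrightarrow> r = 0 \<or> (r, c) \<in> S) \<and>
     (\<forall>r c. (r, Suc c) \<in> S \<longrightarrow> c = 0 \<or> (r, c) \<in> S)"

definition addable :: "(nat \<times> nat) set \<Rightarrow> (nat \<times> nat) set" where
  "addable S = {(r, c). 0 < r \<and> 0 < c \<and> (r, c) \<notin> S \<and>
     (r = 1 \<or> (r - 1, c) \<in> S) \<and> (c = 1 \<or> (r, c - 1) \<in> S)}"

definition removable :: "(nat \<times> nat) set \<Rightarrow> (nat \<times> nat) set" where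
  "removable S = {(r, c) \<in> S. (Suc r, c) \<notin> S \<and> (r, Suc c) \<notin> S}"

lemma diagram_empty [simp]: "diagram {}"
  by (simp add: diagram_def)

lemma diagram_down_closed:
  assumes "diagram S" "(r, c) \<in> S" "0 < r'" "r' \<le> r" "0 < c'" "c' \<le> c"
  shows "(r', c') \<in> S"
proof -
  have "(r', c) \<in> S"
    using \<open>r' \<le> r\<close> assms(2)
  proof (induction r rule: dec_induct)
    case (step m)
    then show ?case
      using assms(1,3) by (metis diagram_def le_zero_eq not_gr_zero)
  qed
  with \<open>c' \<le> c\<close> show ?thesis
  proof (induction c rule: dec_induct)
    case (step m)
    then show ?case
      using assms(1,5) by (metis diagram_def le_zero_eq not_gr_zero)
  qed
qed

lemma diagram_insert_iff:
  assumes "diagram S" "b \<notin> S"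
  shows "diagram (insert b S) \<longleftrightarrow> b \<in> addable S"
proof (cases b)
  case (Pair r c)
  have "diagram (insert (r, c) S) \<longleftrightarrow> 0 < r \<and> 0 < c \<and>
      (r = 1 \<or> (r - 1, c) \<in> S) \<and> (c = 1 \<or> (r, c - 1) \<in> S)"
    (is "?L \<longleftrightarrow> ?R")
  proof
    assume ?L
    then show ?R
      by (cases r; cases c) (auto simp: diagram_def)
  next
    assume ?R
    then show ?L
      using assms(1) by (auto simp: diagram_def)
  qed
  then show ?thesis
    using assms(2) Pair by (auto simp: addable_def)
qed

lemma finite_addable:
  assumes "finite S"
  shows "finite (addable S)"
proof (rule finite_subset)
  show "addable S \<subseteq> {(1, 1)} \<union> (\<lambda>(r, c). (Suc r, c)) ` S \<union> (\<lambda>(r, c). (r, Suc c)) ` S"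
  proof (rule subsetI)
    fix b assume b: "b \<in> addable S"
    obtain r c where [simp]: "b = (r, c)" by (cases b)
    from b consider "b = (1, 1)" | "0 < r" "(r - 1, c) \<in> S" | "0 < c" "(r, c - 1) \<in> S"
      by (auto simp: addable_def)
    then show "b \<in> {(1, 1)} \<union> (\<lambda>(r, c). (Suc r, c)) ` S \<union> (\<lambda>(r, c). (r, Suc c)) ` S"
    proof cases
      case 2
      then have "(\<lambda>(r, c). (Suc r, c)) (r - 1, c) = b"
        by simp
      with 2 show ?thesis by blast
    next
      case 3
      then have "(\<lambda>(r, c). (r, Suc c)) (r, c - 1) = b"
        by simp
      with 3 show ?thesis by blast
    qed simp
  qed
qed (use assms in simp)

lemma finite_removable: "finite S \<Longrightarrow> finite (removable S)"
  by (rule finite_subset[of _ S]) (auto simp: removable_def)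

text \<open>This is the identity (1-x)(1-y)[S] = 1 - [addable] + xy [removable] with the negative
  terms moved across. Multisets are needed since the shifted copies of \<open>S\<close>
  overlap.\<close>

lemma corner_mset_eq:
  assumes "finite S" "diagram S"
  shows "mset_set S + mset_set ((\<lambda>(r, c). (Suc r, Suc c)) ` S) + mset_set (addable S) =
    mset_set {(1, 1)} + mset_set ((\<lambda>(r, c). (r, Suc c)) ` S) +
    mset_set ((\<lambda>(r, c). (Suc r, c)) ` S) + mset_set ((\<lambda>(r, c). (Suc r, Suc c)) ` removable S)"
proof (rule multiset_eqI)
  fix b :: "nat \<times> nat"
  obtain r c where b: "b = (r, c)" by (cases b)
  have imgs: "(r, c) \<in> (\<lambda>(r, c). (Suc r, Suc c)) ` X \<longleftrightarrow> (\<exists>r' c'. r = Suc r' \<and> c = Suc c' \<and> (r', c') \<in> X)"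
    "(r, c) \<in> (\<lambda>(r, c). (r, Suc c)) ` X \<longleftrightarrow> (\<exists>c'. c = Suc c' \<and> (r, c') \<in> X)"
    "(r, c) \<in> (\<lambda>(r, c). (Suc r, c)) ` X \<longleftrightarrow> (\<exists>r'. r = Suc r' \<and> (r', c) \<in> X)" for X
    by auto
  have cnt: "count (mset_set X) (r, c) = (if (r, c) \<in> X then 1 else 0)" if "finite X" for X
    using that by simp
  have "count (mset_set S) (r, c) + count (mset_set ((\<lambda>(r, c). (Suc r, Suc c)) ` S)) (r, c) +
      count (mset_set (addable S)) (r, c) =
    count (mset_set {(1, 1)}) (r, c) + count (mset_set ((\<lambda>(r, c). (r, Suc c)) ` S)) (r, c) +
      count (mset_set ((\<lambda>(r, c). (Suc r, c)) ` S)) (r, c) +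
      count (mset_set ((\<lambda>(r, c). (Suc r, Suc c)) ` removable S)) (r, c)"
  proof (cases "0 < r \<and> 0 < c")
    case False
    have z: "(x, 0) \<notin> S" "(0, x) \<notin> S" for x
      using assms(2) unfolding diagram_def by (metis less_irrefl)+
    show ?thesis
      using False z by (auto simp: assms finite_addable finite_removable imgs cnt addable_def)
  next
    case True
    then obtain r' c' where rc: "r = Suc r'" "c = Suc c'"
      by (metis gr0_implies_Suc)
    \<comment> \<open>Both multiplicities at \<open>(r, c)\<close> depend only on which boxes of the
      2 by 2 square with upper right corner \<open>(r, c)\<close> lie in \<open>S\<close>, and on
      whether that square meets the boundary. Closure rules out the patterns where the counts would
      differ.\<close>
    have "(r, c) \<in> S \<longrightarrow> r' = 0 \<or> (r', c) \<in> S" "(r, c) \<in> S \<longrightarrow> c' = 0 \<or> (r, c') \<in> S"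
      "(r', c) \<in> S \<longrightarrow> 0 < r' \<and> (c' = 0 \<or> (r', c') \<in> S)"
      "(r, c') \<in> S \<longrightarrow> 0 < c' \<and> (r' = 0 \<or> (r', c') \<in> S)"
      "(r', c') \<in> S \<longrightarrow> 0 < r' \<and> 0 < c'"
      using assms(2) unfolding diagram_def rc by blast+
    then show ?thesis
      unfolding cnt[OF assms(1)] cnt[OF finite_addable[OF assms(1)]]
        cnt[OF finite_imageI[OF assms(1)]]
        cnt[OF finite_imageI[OF finite_removable[OF assms(1)]]] imgs
      by (cases "(r, c) \<in> S"; cases "(r', c) \<in> S"; cases "(r, c') \<in> S"; cases "(r', c') \<in> S")
        (simp_all add: rc addable_def removable_def)
  qed
  then show "count (mset_set S + mset_set ((\<lambda>(r, c). (Suc r, Suc c)) ` S) + mset_set (addable S)) b =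
    count (mset_set {(1, 1)} + mset_set ((\<lambda>(r, c). (r, Suc c)) ` S) +
    mset_set ((\<lambda>(r, c). (Suc r, c)) ` S) + mset_set ((\<lambda>(r, c). (Suc r, Suc c)) ` removable S)) b"
    by (simp only: b count_union)
qed

text \<open>The target is an arbitrary commutative monoid because \<open>f\<close> will take values
  both in power series and in the field, and because no inverses are available before the linear
  factors are known to be nonzero.\<close>

lemma prod_corners:
  fixes f :: "nat \<times> nat \<Rightarrow> 'a::comm_monoid_mult"
  assumes "finite S" "diagram S"
  shows "(\<Prod>b\<in>S. f b) * (\<Prod>(r, c)\<in>S. f (Suc r, Suc c)) * (\<Prod>b\<in>addable S. f b) =
    f (1, 1) * (\<Prod>(r, c)\<in>S. f (r, Suc c)) * (\<Prod>(r, c)\<in>S. f (Suc r, c)) *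
    (\<Prod>(r, c)\<in>removable S. f (Suc r, Suc c))"
proof -
  have re: "(\<Prod>b\<in>h ` X. f b) = (\<Prod>b\<in>X. f (h b))" if "inj h" for h :: "nat \<times> nat \<Rightarrow> nat \<times> nat" and X
    using that by (subst prod.reindex) (auto intro: inj_on_subset)
  have inj: "inj (\<lambda>(r :: nat, c :: nat). (Suc r, Suc c))" "inj (\<lambda>(r :: nat, c :: nat). (r, Suc c))"
    "inj (\<lambda>(r :: nat, c :: nat). (Suc r, c))"
    by (auto simp: inj_def)
  from arg_cong[OF corner_mset_eq[OF assms], of "\<lambda>M. prod_mset (image_mset f M)"]
  show ?thesis
    unfolding image_mset_union prod_mset_Un prod_unfold_prod_mset[symmetric] re[OF inj(1)] re[OF inj(2)] re[OF inj(3)]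
    by (simp add: case_prod_unfold)
qed

text \<open>Comparing sizes in the corner identity, \<open>S\<close> counts twice on each side. The
  excess of one makes the rational function of a column proper, so that its partial fractions have
  no polynomial part.\<close>

lemma card_addable:
  assumes "finite S" "diagram S"
  shows "card (addable S) = Suc (card (removable S))"
proof -
  have inj: "inj (\<lambda>(r :: nat, c :: nat). (Suc r, Suc c))" "inj (\<lambda>(r :: nat, c :: nat). (r, Suc c))"
    "inj (\<lambda>(r :: nat, c :: nat). (Suc r, c))"
    by (auto simp: inj_def)
  from arg_cong[OF corner_mset_eq[OF assms], of size] show ?thesis
    by (simp add: card_image inj_on_subset[OF inj(1)] inj_on_subset[OF inj(2)] inj_on_subset[OF inj(3)])
qed

subsection \<open>Tableaux as growth sequences of boxes\<close>

text \<open>A standard tableau recorded by the position \<open>s i\<close> of each entry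
  \<open>i\<close>: every initial segment of positions must be a diagram. Here adding the next entry
  is a function update, whereas in a partition it would change the shape.\<close>

definition growth :: "nat \<Rightarrow> (nat \<Rightarrow> nat \<times> nat) set" where
  "growth n = {s \<in> extensional {1..n}. inj_on s {1..n} \<and> (\<forall>k\<le>n. diagram (s ` {1..k}))}"

lemma growth_1: "growth 1 = {restrict (\<lambda>_. (1, 1)) {1}}"
proof -
  have "diagram {b} \<longleftrightarrow> b = (1, 1)" for b
    by (cases b) (auto simp: diagram_def gr0_conv_Suc)
  moreover have "(\<forall>k\<le>1. diagram (s ` {1..k})) \<longleftrightarrow> diagram {s 1}" for s :: "nat \<Rightarrow> nat \<times> nat"
  proof -
    have "(\<forall>k\<le>1. P k) \<longleftrightarrow> P 0 \<and> P 1" for P :: "nat \<Rightarrow> bool"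
      by (auto simp: le_Suc_eq)
    from this[of "\<lambda>k. diagram (s ` {1..k})"] show ?thesis
      by simp
  qed
  ultimately show ?thesis
    by (auto simp: growth_def extensional_def fun_eq_iff)
qed

lemma bij_betw_growth_Suc:
  "bij_betw (\<lambda>(s, b). s(Suc k := b)) (SIGMA s:growth k. addable (s ` {1..k})) (growth (Suc k))"
proof (rule bij_betw_byWitness[where f' = "\<lambda>s. (restrict s {1..k}, s (Suc k))"])
  let ?D = "SIGMA s:growth k. addable (s ` {1..k})"
  have ivl: "{1..Suc k} = insert (Suc k) {1..k}"
    by auto
  show "\<forall>x\<in>?D. (restrict (case x of (s, b) \<Rightarrow> s(Suc k := b)) {1..k},
      (case x of (s, b) \<Rightarrow> s(Suc k := b)) (Suc k)) = x"
    by (auto simp: growth_def extensional_def fun_eq_iff restrict_def)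
  show "\<forall>s\<in>growth (Suc k). (case (restrict s {1..k}, s (Suc k)) of (s, b) \<Rightarrow> s(Suc k := b)) = s"
    by (auto simp: growth_def extensional_def fun_eq_iff restrict_def le_Suc_eq)
  show "(\<lambda>(s, b). s(Suc k := b)) ` ?D \<subseteq> growth (Suc k)"
  proof clarify
    fix s :: "nat \<Rightarrow> nat \<times> nat" and b1 b2 :: nat
    let ?b = "(b1, b2)"
    let ?s = "s(Suc k := ?b)"
    assume s: "s \<in> growth k" and b: "?b \<in> addable (s ` {1..k})"
    have notin: "?b \<notin> s ` {1..k}"
      using b by (auto simp: addable_def)
    have img: "?s ` {1..j} = s ` {1..j}" if "j \<le> k" for j
      using that by (intro image_cong) auto
    have "inj_on ?s {1..Suc k}"
    proof -
      have "inj_on ?s {1..k}"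
        using s inj_on_cong[of "{1..k}" ?s s] by (simp add: growth_def)
      moreover have "{1..k} - {Suc k} = {1..k}"
        by auto
      ultimately show ?thesis
        using notin unfolding ivl inj_on_insert by (simp only: img[OF order.refl]) simp
    qed
    moreover have "?s \<in> extensional {1..Suc k}"
      using s by (auto simp: growth_def extensional_def)
    moreover have "diagram (?s ` {1..Suc k})"
    proof -
      have "?s ` {1..Suc k} = insert ?b (s ` {1..k})"
        unfolding ivl image_insert img[OF order.refl] by simp
      then show ?thesis
        using s b notin by (simp add: diagram_insert_iff growth_def)
    qed
    then have "diagram (?s ` {1..j})" if "j \<le> Suc k" for j
      using that s img by (cases "j = Suc k") (auto simp: growth_def)
    ultimately show "?s \<in> growth (Suc k)"
      by (simp add: growth_def)
  qed
  show "(\<lambda>s. (restrict s {1..k}, s (Suc k))) ` growth (Suc k) \<subseteq> ?D"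
  proof (rule image_subsetI)
    fix s assume s: "s \<in> growth (Suc k)"
    have img: "restrict s {1..k} ` {1..j} = s ` {1..j}" if "j \<le> k" for j
      using that by (intro image_cong) auto
    have "inj_on (restrict s {1..k}) {1..k}"
      using s by (auto simp: growth_def inj_on_def)
    moreover have "diagram (restrict s {1..k} ` {1..j})" if "j \<le> k" for j
      using s that img[OF that] by (simp add: growth_def)
    ultimately have "restrict s {1..k} \<in> growth k"
      by (simp add: growth_def)
    moreover have "s (Suc k) \<in> addable (s ` {1..k})"
    proof -
      have "s (Suc k) \<notin> s ` {1..k}"
        using s by (force simp: growth_def inj_on_def)
      moreover have "diagram (insert (s (Suc k)) (s ` {1..k}))" "diagram (s ` {1..k})"
        using s unfolding image_insert[symmetric] ivl[symmetric] by (auto simp: growth_def)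
      ultimately show ?thesis
        using diagram_insert_iff by blast
    qed
    ultimately show "(restrict s {1..k}, s (Suc k)) \<in> ?D"
      using img[of k] by simp
  qed
qed

lemma finite_growth: "finite (growth k)"
proof (induction k)
  case 0
  have "growth 0 \<subseteq> {\<lambda>_. undefined}"
    by (auto simp: growth_def)
  then show ?case
    by (rule finite_subset) simp
next
  case (Suc k)
  then show ?case
    using bij_betw_finite[OF bij_betw_growth_Suc[of k]]
    by (auto intro!: finite_SigmaI finite_addable)
qed

text \<open>If the box above or to the right of \<open>s k\<close> had been placed earlier, closure
  of the earlier diagram would force \<open>s k\<close> to have been placed earlier too.\<close>

lemma growth_last_removable:
  assumes "s \<in> growth k" "1 \<le> k"
  shows "s k \<in> removable (s ` {1..k})"
proof -
  obtain r c where rc: "s k = (r, c)"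
    by fastforce
  let ?S = "s ` {1..k-1}"
  have "{1..k} = insert k {1..k-1}"
    using assms(2) by auto
  then have img: "s ` {1..k} = insert (s k) ?S"
    by simp
  have "s k \<notin> ?S"
    using assms inj_on_image_mem_iff[of s "{1..k}" k "{1..k-1}"] by (auto simp: growth_def)
  moreover have "diagram ?S" "diagram (insert (s k) ?S)"
    using assms img by (auto simp: growth_def)
  moreover have "(r, c) \<in> insert (s k) ?S"
    by (simp add: rc)
  then have "0 < r" "0 < c"
    using \<open>diagram (insert (s k) ?S)\<close> unfolding diagram_def by blast+
  ultimately have "(Suc r, c) \<notin> ?S" "(r, Suc c) \<notin> ?S"
    using rc unfolding diagram_def by (metis less_irrefl)+
  then show ?thesis
    unfolding img rc removable_def by simp
qed

section \<open>Finite diagrams are exactly the Young diagrams of partitions\<close>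

lemma initial_segment_nat:
  fixes A :: "nat set"
  assumes "finite A" "0 \<notin> A" "\<And>x. Suc x \<in> A \<Longrightarrow> x = 0 \<or> x \<in> A"
  shows "A = {1..card A}"
proof -
  have down: "x \<in> A" if "y \<in> A" "0 < x" "x \<le> y" for x y
    using that(3,1)
  proof (induction y rule: dec_induct)
    case (step m)
    then show ?case
      using assms(3) that(2) by (metis le_zero_eq not_gr_zero)
  qed
  show ?thesis
  proof (cases "A = {}")
    case False
    have "A = {1..Max A}"
      using down[OF Max_in[OF assms(1) False]] assms(1,2) by (auto simp: Suc_le_eq intro: gr0I)
    then show ?thesis
      by (metis card_atLeastAtMost diff_Suc_1)
  qed simp
qed

lemma young_diagram_eq_Sigma:
  "young_diagram lam = (SIGMA r:{1..length lam}. {1..lam ! (r - 1)})"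
  by (auto simp: young_diagram_def)

lemma card_young_diagram: "card (young_diagram lam) = sum_list lam"
proof -
  have "card (young_diagram lam) = (\<Sum>r\<in>{1..length lam}. lam ! (r - 1))"
    unfolding young_diagram_eq_Sigma by simp
  also have "\<dots> = (\<Sum>i\<in>{0..<length lam}. lam ! i)"
    by (rule sum.reindex_bij_witness[where i = Suc and j = "\<lambda>r. r - 1"]) auto
  finally show ?thesis
    by (simp add: sum_list_sum_nth)
qed

lemma diagram_young_diagram:
  assumes "is_partition n lam"
  shows "diagram (young_diagram lam)"
proof -
  have step: "lam ! r \<le> lam ! (r - 1)" if "r < length lam" for r
    using assms that sorted_wrt_nth_less[of "(\<ge>)" lam "r - 1" r]
    by (cases r) (auto simp: is_partition_def)
  have "r = 0 \<or> (r, c) \<in> young_diagram lam" if "(Suc r, c) \<in> young_diagram lam" for r c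
    using that step[of r] by (auto simp: young_diagram_def)
  moreover have "c = 0 \<or> (r, c) \<in> young_diagram lam" if "(r, Suc c) \<in> young_diagram lam" for r c
    using that by (auto simp: young_diagram_def)
  moreover have "0 < r \<and> 0 < c" if "(r, c) \<in> young_diagram lam" for r c
    using that by (auto simp: young_diagram_def)
  ultimately show ?thesis
    unfolding diagram_def by blast
qed

text \<open>The parts are the row lengths, and their number is the length of the first column. The
  latter uses that all parts are positive, since a zero part would leave no trace in the
  diagram.\<close>

lemma young_diagram_inj:
  assumes "is_partition n lam" "is_partition n' lam'" "young_diagram lam = young_diagram lam'"
  shows "lam = lam'"
proof -
  have pos: "0 < mu ! i" if "is_partition m mu" "i < length mu" for m mu i
    using that by (metis gr0I is_partition_def nth_mem)
  have len: "length mu = card {r. (r, 1) \<in> young_diagram mu}" if "is_partition m mu" for m mu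
  proof -
    have "{r. (r, 1) \<in> young_diagram mu} = {1..length mu}"
      using pos[OF that] by (force simp: young_diagram_def Suc_le_eq)
    then show ?thesis
      by simp
  qed
  have row: "mu ! i = card {c. (Suc i, c) \<in> young_diagram mu}" if "i < length mu" for mu i
  proof -
    have "{c. (Suc i, c) \<in> young_diagram mu} = {1..mu ! i}"
      using that by (auto simp: young_diagram_def)
    then show ?thesis
      by simp
  qed
  show ?thesis
    using assms len[OF assms(1)] len[OF assms(2)] row by (intro nth_equalityI) auto
qed

text \<open>The parts are the row cardinalities, listed over the first column. Rows and first column
  are initial segments of the positive integers, and closure downwards makes the row lengths weakly
  decrease.\<close>

lemma ex_partition_of_diagram:
  assumes fin: "finite S" and S: "diagram S"
  shows "\<exists>lam. is_partition (card S) lam \<and> young_diagram lam = S"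
proof -
  define row where "row r = {c. (r, c) \<in> S}" for r
  define col where "col = {r. (r, 1) \<in> S}"
  define lam where "lam = map (\<lambda>i. card (row (Suc i))) [0..<card col]"
  have fin_row: "finite (row r)" for r
    using finite_imageI[OF fin, of snd] by (rule rev_finite_subset) (force simp: row_def)
  have "finite col"
    using finite_imageI[OF fin, of fst] by (rule rev_finite_subset) (force simp: col_def)
  then have col: "col = {1..card col}"
    by (rule initial_segment_nat) (use S in \<open>force simp: col_def diagram_def\<close>)+
  have row: "row r = {1..card (row r)}" for r
    using fin_row by (rule initial_segment_nat) (use S in \<open>force simp: row_def diagram_def\<close>)+
  have "(r, c) \<in> S \<longleftrightarrow> 1 \<le> r \<and> r \<le> card col \<and> 1 \<le> c \<and> c \<le> card (row r)" for r c
  proof -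
    have "(r, c) \<in> S \<longleftrightarrow> c \<in> {1..card (row r)}"
      using row[of r] by (auto simp: row_def)
    moreover have "r \<in> {1..card col}" if "(r, c) \<in> S"
    proof -
      have "0 < r" "0 < c"
        using S that by (auto simp: diagram_def)
      then have "(r, 1) \<in> S"
        using diagram_down_closed[OF S that, of r 1] by simp
      then show ?thesis
        using col by (simp add: col_def)
    qed
    ultimately show ?thesis
      by auto
  qed
  then have yd: "young_diagram lam = S"
    by (auto simp: young_diagram_def lam_def Suc_le_eq gr0_conv_Suc)
  have "sorted_wrt (\<ge>) lam"
  proof -
    have "card (row (Suc j)) \<le> card (row (Suc i))" if "i < j" for i j
    proof (rule card_mono[OF fin_row])
      show "row (Suc j) \<subseteq> row (Suc i)"
      proof
        fix c assume "c \<in> row (Suc j)"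
        then show "c \<in> row (Suc i)"
          using S that diagram_down_closed[OF S, of "Suc j" c "Suc i" c]
          by (auto simp: row_def diagram_def)
      qed
    qed
    then show ?thesis
      by (simp add: lam_def sorted_wrt_iff_nth_less)
  qed
  moreover have "0 \<notin> set lam"
  proof
    assume "0 \<in> set lam"
    then obtain i where i: "i < card col" "card (row (Suc i)) = 0"
      by (auto simp: lam_def)
    then have "Suc i \<in> {1..card col}"
      by simp
    with col have "(Suc i, 1) \<in> S"
      by (auto simp: col_def)
    with i fin_row show False
      by (auto simp: row_def)
  qed
  ultimately have "is_partition (card S) lam"
    using card_young_diagram[of lam] by (simp add: is_partition_def yd)
  with yd show ?thesis
    by blast
qed

definition growth_of :: "nat \<Rightarrow> nat list \<times> (nat \<times> nat \<Rightarrow> nat) \<Rightarrow> nat \<Rightarrow> nat \<times> nat" where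
  "growth_of n = (\<lambda>(lam, T). restrict (inv_into (young_diagram lam) T) {1..n})"

text \<open>The first \<open>k\<close> boxes form the sublevel set of entries at most
  \<open>k\<close>. It is closed because moving left or down in the Young diagram decreases the
  entry.\<close>

lemma growth_of_mem:
  assumes "(lam, T) \<in> standard_young_tableaux n"
  shows "growth_of n (lam, T) \<in> growth n"
proof -
  let ?Y = "young_diagram lam"
  let ?s = "growth_of n (lam, T)"
  have part: "is_partition n lam" and bij: "bij_betw T ?Y {1..n}"
    and less1: "\<And>r c c'. (r, c) \<in> ?Y \<Longrightarrow> (r, c') \<in> ?Y \<Longrightarrow> c < c' \<Longrightarrow> T (r, c) < T (r, c')"
    and less2: "\<And>r r' c. (r, c) \<in> ?Y \<Longrightarrow> (r', c) \<in> ?Y \<Longrightarrow> r < r' \<Longrightarrow> T (r, c) < T (r', c)"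
    using assms by (auto simp: standard_young_tableaux_def)
  have "inj_on ?s {1..n}"
    using bij_betw_inv_into[OF bij] by (simp add: growth_of_def bij_betw_def inj_on_restrict_eq)
  moreover have "diagram (?s ` {1..k})" if "k \<le> n" for k
  proof -
    have img: "?s ` {1..k} = {b \<in> ?Y. T b \<le> k}"
    proof (intro subset_antisym subsetI)
      fix b assume "b \<in> ?s ` {1..k}"
      then obtain i where i: "i \<in> {1..k}" "b = ?s i"
        by auto
      then have "b = inv_into ?Y T i" "i \<in> T ` ?Y"
        using that bij by (auto simp: growth_of_def bij_betw_def)
      then show "b \<in> {b \<in> ?Y. T b \<le> k}"
        using i by (simp add: f_inv_into_f inv_into_into)
    next
      fix b assume b: "b \<in> {b \<in> ?Y. T b \<le> k}"
      then have "T b \<in> {1..k}" "inv_into ?Y T (T b) = b"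
        using bij by (auto simp: bij_betw_def)
      then show "b \<in> ?s ` {1..k}"
        using that by (auto simp: growth_of_def intro!: image_eqI[of _ _ "T b"])
    qed
    have "diagram ?Y"
      using part by (rule diagram_young_diagram)
    then show ?thesis
      unfolding img diagram_def mem_Collect_eq by (meson less1 less2 lessI less_or_eq_imp_le order.trans)
  qed
  ultimately show ?thesis
    by (simp add: growth_def growth_of_def)
qed

text \<open>In the inverse direction the shape is the set of all boxes of \<open>s\<close>, and the
  filling sends a box to the time at which \<open>s\<close> reaches it.\<close>

lemma bij_betw_growth_of: "bij_betw (growth_of n) (standard_young_tableaux n) (growth n)"
  unfolding bij_betw_def
proof
  show "inj_on (growth_of n) (standard_young_tableaux n)"
  proof (rule inj_onI, clarify)
    fix lam lam' T T'
    assume T: "(lam, T) \<in> standard_young_tableaux n" "(lam', T') \<in> standard_young_tableaux n"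
      and eq: "growth_of n (lam, T) = growth_of n (lam', T')"
    note props = T[unfolded standard_young_tableaux_def mem_Collect_eq prod.case]
    have img: "growth_of n (mu, U) ` {1..n} = young_diagram mu"
      if "bij_betw U (young_diagram mu) {1..n}" for mu U
      using bij_betw_inv_into[OF that] by (simp add: growth_of_def bij_betw_def)
    have Y: "young_diagram lam = young_diagram lam'"
      using img[of T lam] img[of T' lam'] props eq by simp
    moreover have "T b = T' b" if "b \<in> young_diagram lam" for b
    proof -
      have Tb: "T b \<in> {1..n}"
        using props(1) that by (auto simp: bij_betw_def)
      have "inv_into (young_diagram lam) T (T b) = b"
        using props(1) that by (simp add: bij_betw_def)
      moreover have "inv_into (young_diagram lam) T (T b) = inv_into (young_diagram lam') T' (T b)"
        using fun_cong[OF eq, of "T b"] Tb by (simp add: growth_of_def)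
      moreover have "T b \<in> T' ` young_diagram lam'"
        using props(2) Tb by (simp add: bij_betw_def)
      ultimately show ?thesis
        using f_inv_into_f by metis
    qed
    then have "T = T'"
      using props Y by (metis extensionalityI)
    ultimately show "lam = lam' \<and> T = T'"
      using props young_diagram_inj by blast
  qed
  show "growth_of n ` standard_young_tableaux n = growth n"
  proof (intro subset_antisym subsetI)
    fix s assume "s \<in> growth_of n ` standard_young_tableaux n"
    then show "s \<in> growth n"
      using growth_of_mem by auto
  next
    fix s assume s: "s \<in> growth n"
    let ?S = "s ` {1..n}"
    have inj: "inj_on s {1..n}" and dia: "\<And>k. k \<le> n \<Longrightarrow> diagram (s ` {1..k})"
      and ext: "s \<in> extensional {1..n}"
      using s by (auto simp: growth_def)
    obtain lam where lam: "is_partition n lam" "young_diagram lam = ?S"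
      using ex_partition_of_diagram[of ?S] dia[of n] card_image[OF inj] by auto
    let ?T = "restrict (inv_into {1..n} s) ?S"
    have bij_s: "bij_betw s {1..n} ?S"
      using inj by (simp add: bij_betw_def)
    then have bij: "bij_betw ?T ?S {1..n}"
      using bij_betw_inv_into by (metis bij_betw_restrict_eq)
    have T_s: "?T (s i) = i" if "i \<in> {1..n}" for i
      using that inj by simp
    have mono: "?T (r, c) < ?T (r', c')"
      if mem: "(r, c) \<in> ?S" "(r', c') \<in> ?S" and le: "r \<le> r'" "c \<le> c'"
        and neq: "(r, c) \<noteq> (r', c')" for r c r' c'
    proof -
      obtain j where j: "j \<in> {1..n}" "s j = (r', c')"
        using mem(2) by force
      have pos: "0 < r" "0 < c"
        using mem(1) dia[of n] unfolding diagram_def by blast+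
      \<comment> \<open>The boxes placed up to time \<open>j\<close> already form a diagram, so
        every box weakly below and to the left of \<open>s j\<close> was placed by then. This is the
        monotonicity of the filling.\<close>
      have "(r', c') \<in> s ` {1..j}"
        using j by force
      then have "(r, c) \<in> s ` {1..j}"
        using diagram_down_closed[OF dia[of j]] j pos le by auto
      then obtain i where i: "i \<in> {1..j}" "s i = (r, c)"
        by force
      moreover have "i \<noteq> j"
        using i j neq by auto
      ultimately show ?thesis
        using j T_s[of i] T_s[of j] by auto
    qed
    have "(lam, ?T) \<in> standard_young_tableaux n"
      unfolding standard_young_tableaux_def mem_Collect_eq prod.case lam(2)
      using lam(1) bij mono by (intro conjI allI impI) auto
    moreover have "growth_of n (lam, ?T) = s"
    proof
      fix i
      show "growth_of n (lam, ?T) i = s i"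
      proof (cases "i \<in> {1..n}")
        case True
        then have "inv_into ?S ?T i = s i"
          using bij T_s by (intro inv_into_f_eq) (auto simp: bij_betw_def)
        with True show ?thesis
          by (simp add: growth_of_def lam(2))
      next
        case False
        with ext show ?thesis
          by (auto simp: growth_of_def extensional_def)
      qed
    qed
    ultimately show "s \<in> growth_of n ` standard_young_tableaux n"
      by (metis image_eqI)
  qed
qed

subsection \<open>Partial fractions\<close>

lemma fps_geometric_mult_linear:
  fixes c :: "'a::comm_ring_1"
  shows "Abs_fps (\<lambda>p. c ^ p) * (1 - fps_const c * fps_X) = 1"
proof (rule fps_ext)
  fix p
  show "fps_nth (Abs_fps (\<lambda>p. c ^ p) * (1 - fps_const c * fps_X)) p = fps_nth 1 p"
    by (cases p) (simp_all add: algebra_simps)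
qed

lemma fps_of_poly_linear:
  fixes c :: "'a::comm_ring_1"
  shows "fps_of_poly [:1, - c:] = 1 - fps_const c * fps_X"
proof (rule fps_ext)
  fix p
  show "fps_nth (fps_of_poly [:1, - c:]) p = fps_nth (1 - fps_const c * fps_X) p"
    by (cases p) (auto simp: coeff_pCons split: nat.split)
qed

text \<open>Lagrange interpolation of \<open>N\<close> at the points 1/\<open>w b\<close>, followed
  by division by the product of all linear factors. Each basis polynomial leaves a single geometric
  series.\<close>

lemma fps_partial_fractions:
  fixes w :: "'b \<Rightarrow> 'a::field"
  assumes fin: "finite B" and inj: "inj_on w B" and nz: "\<And>b. b \<in> B \<Longrightarrow> w b \<noteq> 0"
    and deg: "degree N < card B"
    and R: "R * (\<Prod>b\<in>B. 1 - fps_const (w b) * fps_X) = fps_of_poly N"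
  shows "fps_nth R p =
    (\<Sum>b\<in>B. poly N (inverse (w b)) / (\<Prod>b'\<in>B - {b}. 1 - w b' / w b) * w b ^ p)"
proof -
  define c where "c b = poly N (inverse (w b)) / (\<Prod>b'\<in>B - {b}. 1 - w b' / w b)" for b
  \<comment> \<open>The unnormalised Lagrange basis: \<open>L b\<close> vanishes at the inverse of
    every \<open>w b'\<close> with b' different from b, and \<open>c b\<close> divides by its value
    at the inverse of \<open>w b\<close>.\<close>
  define L where "L b = (\<Prod>b'\<in>B - {b}. [:1, - w b':])" for b
  have L_same: "poly (L b) (inverse (w b)) = (\<Prod>b'\<in>B - {b}. 1 - w b' / w b)" for b
    by (simp add: L_def poly_prod divide_inverse algebra_simps)
  have L_other: "poly (L b) (inverse (w b')) = 0" if "b \<noteq> b'" "b' \<in> B" for b b'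
    using that fin nz by (auto simp: L_def poly_prod intro!: bexI[of _ b'])
  have nonzero: "(\<Prod>b'\<in>B - {b}. 1 - w b' / w b) \<noteq> 0" if "b \<in> B" for b
    using that fin nz inj by (auto simp: inj_on_def)
  have "N = (\<Sum>b\<in>B. smult (c b) (L b))"
  proof (rule poly_eqI_degree[where A = "(\<lambda>b. inverse (w b)) ` B"])
    have "inj_on (\<lambda>b. inverse (w b)) B"
      using inj by (auto simp: inj_on_def)
    then have card: "card ((\<lambda>b. inverse (w b)) ` B) = card B"
      by (rule card_image)
    then show "degree N < card ((\<lambda>b. inverse (w b)) ` B)"
      using deg by simp
    have "degree (smult (c b) (L b)) \<le> card B - 1" if "b \<in> B" for b
    proof -
      have "degree (smult (c b) (L b)) \<le> degree (L b)"
        by (rule degree_smult_le)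
      also have "\<dots> \<le> (\<Sum>b'\<in>B - {b}. degree [:1, - w b':])"
        unfolding L_def by (rule degree_prod_sum_le[unfolded o_def, OF finite_Diff[OF fin]])
      also have "\<dots> \<le> (\<Sum>b'\<in>B - {b}. 1)"
        by (intro sum_mono) simp
      finally show ?thesis
        using that fin by simp
    qed
    then have "degree (\<Sum>b\<in>B. smult (c b) (L b)) \<le> card B - 1"
      using fin by (intro degree_sum_le)
    then show "degree (\<Sum>b\<in>B. smult (c b) (L b)) < card ((\<lambda>b. inverse (w b)) ` B)"
      using deg card by simp
  next
    fix x assume "x \<in> (\<lambda>b. inverse (w b)) ` B"
    then obtain b where b: "b \<in> B" "x = inverse (w b)"
      by auto
    have "poly (\<Sum>b\<in>B. smult (c b) (L b)) x = (\<Sum>b'\<in>B. if b' = b then c b * poly (L b) x else 0)"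
      unfolding poly_sum by (intro sum.cong) (auto simp: b L_other)
    also have "\<dots> = poly N x"
      using b fin nonzero[OF b(1)] by (simp add: L_same c_def)
    finally show "poly N x = poly (\<Sum>b\<in>B. smult (c b) (L b)) x"
      by simp
  qed
  then have N: "fps_of_poly N = (\<Sum>b\<in>B. fps_const (c b) * (\<Prod>b'\<in>B - {b}. 1 - fps_const (w b') * fps_X))"
    by (simp add: L_def fps_of_poly_sum fps_of_poly_smult fps_of_poly_prod fps_of_poly_linear)
  let ?P = "\<Prod>b\<in>B. 1 - fps_const (w b) * fps_X"
  let ?g = "\<lambda>b. Abs_fps (\<lambda>p. w b ^ p)"
  have "(\<Sum>b\<in>B. fps_const (c b) * ?g b) * ?P = fps_of_poly N"
    unfolding N sum_distrib_right
  proof (rule sum.cong)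
    fix b assume "b \<in> B"
    then have "?P = (1 - fps_const (w b) * fps_X) * (\<Prod>b'\<in>B - {b}. 1 - fps_const (w b') * fps_X)"
      using fin by (rule prod.remove[rotated])
    then have "fps_const (c b) * ?g b * ?P = fps_const (c b) *
        (?g b * (1 - fps_const (w b) * fps_X)) * (\<Prod>b'\<in>B - {b}. 1 - fps_const (w b') * fps_X)"
      by (simp only: mult_ac)
    then show "fps_const (c b) * ?g b * ?P =
        fps_const (c b) * (\<Prod>b'\<in>B - {b}. 1 - fps_const (w b') * fps_X)"
      by (simp add: fps_geometric_mult_linear)
  qed simp
  moreover have "?P \<noteq> 0"
  proof -
    have "fps_nth (1 - fps_const (w b) * fps_X) 0 \<noteq> 0" for b
      by simp
    then have "1 - fps_const (w b) * fps_X \<noteq> 0" for b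
      by (metis fps_zero_nth)
    then show ?thesis
      using fin by simp
  qed
  ultimately have "R = (\<Sum>b\<in>B. fps_const (c b) * ?g b)"
    unfolding R[symmetric] by simp
  then show ?thesis
    by (simp add: fps_sum_nth c_def)
qed

text \<open>Functions forced to vanish off \<open>I\<close>, so that a composition is represented
  once and can be inserted unchanged as a matrix column.\<close>

definition weak_compositions :: "'a set \<Rightarrow> nat \<Rightarrow> ('a \<Rightarrow> nat) set" where
  "weak_compositions I p = {e. (\<forall>i. i \<notin> I \<longrightarrow> e i = 0) \<and> sum e I = p}"

lemma finite_weak_compositions:
  assumes "finite I"
  shows "finite (weak_compositions I p)"
proof (rule finite_subset)
  show "weak_compositions I p \<subseteq> {e. \<forall>i. (i \<in> I \<longrightarrow> e i \<in> {..p}) \<and> (i \<notin> I \<longrightarrow> e i = 0)}"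
    using assms by (auto simp: weak_compositions_def intro: member_le_sum)
qed (use assms in \<open>intro finite_set_of_finite_funs finite_atMost\<close>)

lemma fps_nth_prod_eq:
  fixes f :: "'b \<Rightarrow> 'a::comm_ring_1 fps"
  assumes "finite I"
  shows "fps_nth (\<Prod>i\<in>I. f i) p = (\<Sum>e\<in>weak_compositions I p. \<Prod>i\<in>I. fps_nth (f i) (e i))"
  using assms
proof (induction I arbitrary: p rule: finite_induct)
  case empty
  show ?case
  proof (cases "p = 0")
    case True
    then have "weak_compositions ({} :: 'b set) p = {\<lambda>_. 0}"
      by (auto simp: weak_compositions_def)
    with True show ?thesis
      by simp
  next
    case False
    then have "weak_compositions ({} :: 'b set) p = {}"
      by (auto simp: weak_compositions_def)
    with False show ?thesis
      by simp
  qed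
next
  case (insert i I)
  let ?D = "SIGMA j:{0..p}. weak_compositions I (p - j)"
  have "fps_nth (\<Prod>i\<in>insert i I. f i) p =
      (\<Sum>j=0..p. \<Sum>e\<in>weak_compositions I (p - j). fps_nth (f i) j * (\<Prod>i\<in>I. fps_nth (f i) (e i)))"
    using insert by (simp add: fps_mult_nth sum_distrib_left)
  also have "\<dots> = (\<Sum>(j, e)\<in>?D. fps_nth (f i) j * (\<Prod>i\<in>I. fps_nth (f i) (e i)))"
    by (rule sum.Sigma) (auto intro: finite_weak_compositions insert)
  also have "\<dots> = (\<Sum>e\<in>weak_compositions (insert i I) p. \<Prod>i\<in>insert i I. fps_nth (f i) (e i))"
  proof (rule sum.reindex_bij_witness[where i = "\<lambda>e. (e i, e(i := 0))" and j = "\<lambda>(j, e). e(i := j)"])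
    fix x assume x: "x \<in> ?D"
    obtain j e where [simp]: "x = (j, e)" by (cases x)
    have e: "j \<le> p" "\<forall>k. k \<notin> I \<longrightarrow> e k = 0" "sum e I = p - j"
      using x by (auto simp: weak_compositions_def)
    have [simp]: "sum (e(i := j)) I = sum e I"
      using insert.hyps by (intro sum.cong) auto
    have [simp]: "(\<Prod>k\<in>I. fps_nth (f k) ((e(i := j)) k)) = (\<Prod>k\<in>I. fps_nth (f k) (e k))"
      using insert.hyps by (intro prod.cong) auto
    show "(((case x of (j, e) \<Rightarrow> e(i := j)) i), (case x of (j, e) \<Rightarrow> e(i := j))(i := 0)) = x"
      using e insert.hyps by auto
    show "(case x of (j, e) \<Rightarrow> e(i := j)) \<in> weak_compositions (insert i I) p"
      using e insert.hyps by (auto simp: weak_compositions_def simp del: fun_upd_apply) auto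
    show "(\<Prod>k\<in>insert i I. fps_nth (f k) ((case x of (j, e) \<Rightarrow> e(i := j)) k)) =
        (case x of (j, e) \<Rightarrow> fps_nth (f i) j * (\<Prod>i\<in>I. fps_nth (f i) (e i)))"
      using insert.hyps by (simp del: fun_upd_apply) simp
  next
    fix e assume e: "e \<in> weak_compositions (insert i I) p"
    have [simp]: "sum (e(i := 0)) I = sum e I"
      using insert.hyps by (intro sum.cong) auto
    show "(case (e i, e(i := 0)) of (j, e) \<Rightarrow> e(i := j)) = e"
      by simp
    show "(e i, e(i := 0)) \<in> ?D"
      using e insert.hyps by (auto simp: weak_compositions_def simp del: fun_upd_apply) auto
  qed
  finally show ?case .
qed

subsection \<open>Partial Tesler sums\<close>

text \<open>What remains of a Tesler matrix after deleting columns 1 to \<open>k\<close>: rows 1 to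
  \<open>k\<close> survive in the later columns but carry no condition of their own. The conditions
  are rewritten without subtraction as "column total = \<open>a j\<close> plus the entries of row
  \<open>j\<close> to the right of the diagonal".\<close>

definition partial_tesler :: "nat \<Rightarrow> nat \<Rightarrow> (nat \<Rightarrow> nat) \<Rightarrow> (nat \<Rightarrow> nat \<Rightarrow> nat) set" where
  "partial_tesler k n a = {m.
     (\<forall>i j. \<not> (1 \<le> i \<and> i \<le> j \<and> k < j \<and> j \<le> n) \<longrightarrow> m i j = 0) \<and>
     (\<forall>j\<in>{k<..n}. m j j + (\<Sum>i\<in>{1..<j}. m i j) = a j + (\<Sum>l\<in>{j<..n}. m j l))}"

lemma tesler_matrices_eq: "tesler_matrices n a = partial_tesler 0 n a"
proof -
  have "int x + (\<Sum>j\<in>A. int (f j)) - (\<Sum>j\<in>B. int (g j)) = int y \<longleftrightarrow> x + sum f A = y + sum g B"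
    for x y f g and A B :: "nat set"
    unfolding of_nat_sum[symmetric] by linarith
  moreover have "{0<..n} = {1..n}"
    by auto
  ultimately show ?thesis
    unfolding tesler_matrices_def partial_tesler_def by (auto simp: Suc_le_eq)
qed

lemma partial_tesler_self: "partial_tesler n n a = {\<lambda>_ _. 0}"
  by (auto simp: partial_tesler_def fun_eq_iff)

definition add_column :: "nat \<Rightarrow> (nat \<Rightarrow> nat) \<Rightarrow> (nat \<Rightarrow> nat \<Rightarrow> nat) \<Rightarrow> nat \<Rightarrow> nat \<Rightarrow> nat" where
  "add_column k e m = (\<lambda>i j. if j = k then e i else m i j)"

definition row_total :: "nat \<Rightarrow> (nat \<Rightarrow> nat) \<Rightarrow> nat \<Rightarrow> (nat \<Rightarrow> nat \<Rightarrow> nat) \<Rightarrow> nat" where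
  "row_total n a k m = a k + (\<Sum>l\<in>{k<..n}. m k l)"

text \<open>Column \<open>Suc k\<close> occurs in one condition only, the one fixing its total: the
  row sums of the conditions for \<open>j\<close> involve columns beyond \<open>j\<close>, and
  \<open>j\<close> is at least \<open>Suc k\<close>. Given the later columns, it is therefore an
  arbitrary composition of \<open>row_total\<close>.\<close>

lemma bij_betw_add_column:
  assumes "k < n"
  shows "bij_betw (\<lambda>(m, e). add_column (Suc k) e m)
    (SIGMA m:partial_tesler (Suc k) n a. weak_compositions {1..Suc k} (row_total n a (Suc k) m))
    (partial_tesler k n a)"
proof (rule bij_betw_byWitness[where f' = "\<lambda>m. (add_column (Suc k) (\<lambda>_. 0) m, \<lambda>i. m i (Suc k))"])
  let ?D = "SIGMA m:partial_tesler (Suc k) n a. weak_compositions {1..Suc k} (row_total n a (Suc k) m)"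
  have split: "sum e {1..Suc k} = e (Suc k) + sum e {1..<Suc k}" for e :: "nat \<Rightarrow> nat"
    by (simp add: atLeastLessThanSuc_atLeastAtMost)
  show "\<forall>x\<in>?D. (add_column (Suc k) (\<lambda>_. 0) (case x of (m, e) \<Rightarrow> add_column (Suc k) e m),
      \<lambda>i. (case x of (m, e) \<Rightarrow> add_column (Suc k) e m) i (Suc k)) = x"
    by (auto simp: add_column_def fun_eq_iff partial_tesler_def)
  show "\<forall>m\<in>partial_tesler k n a. (case (add_column (Suc k) (\<lambda>_. 0) m, \<lambda>i. m i (Suc k)) of
      (m, e) \<Rightarrow> add_column (Suc k) e m) = m"
    by (auto simp: add_column_def fun_eq_iff)
  show "(\<lambda>(m, e). add_column (Suc k) e m) ` ?D \<subseteq> partial_tesler k n a"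
  proof clarify
    fix m e
    assume m: "m \<in> partial_tesler (Suc k) n a"
      and e: "e \<in> weak_compositions {1..Suc k} (row_total n a (Suc k) m)"
    let ?m = "add_column (Suc k) e m"
    have "?m i j = 0" if "\<not> (1 \<le> i \<and> i \<le> j \<and> k < j \<and> j \<le> n)" for i j
      using m e that assms by (auto simp: add_column_def partial_tesler_def weak_compositions_def)
    moreover have "?m j j + (\<Sum>i\<in>{1..<j}. ?m i j) = a j + (\<Sum>l\<in>{j<..n}. ?m j l)" if j: "j \<in> {k<..n}" for j
    proof -
      have eq: "(\<Sum>l\<in>{j<..n}. ?m j l) = (\<Sum>l\<in>{j<..n}. m j l)"
        using j by (intro sum.cong) (auto simp: add_column_def)
      show ?thesis
      proof (cases "j = Suc k")
        case True
        have "e (Suc k) + sum e {1..<Suc k} = row_total n a (Suc k) m"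
          using e split[of e] by (simp add: weak_compositions_def)
        with True show ?thesis
          unfolding eq by (simp add: add_column_def row_total_def)
      next
        case False
        with m j show ?thesis
          unfolding eq by (simp add: add_column_def partial_tesler_def)
      qed
    qed
    ultimately show "?m \<in> partial_tesler k n a"
      by (simp add: partial_tesler_def)
  qed
  show "(\<lambda>m. (add_column (Suc k) (\<lambda>_. 0) m, \<lambda>i. m i (Suc k))) ` partial_tesler k n a \<subseteq> ?D"
  proof clarify
    fix m assume m: "m \<in> partial_tesler k n a"
    let ?m = "add_column (Suc k) (\<lambda>_. 0) m"
    have eq: "(\<Sum>l\<in>{j<..n}. ?m j l) = (\<Sum>l\<in>{j<..n}. m j l)" if "k < j" for j
      using that by (intro sum.cong) (auto simp: add_column_def)
    have "?m j j + (\<Sum>i\<in>{1..<j}. ?m i j) = a j + (\<Sum>l\<in>{j<..n}. ?m j l)" if j: "j \<in> {Suc k<..n}" for j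
      using m j eq[of j] by (simp add: add_column_def partial_tesler_def)
    moreover have "?m i j = 0" if "\<not> (1 \<le> i \<and> i \<le> j \<and> Suc k < j \<and> j \<le> n)" for i j
      using m that by (cases "j = Suc k") (auto simp: add_column_def partial_tesler_def)
    ultimately have "?m \<in> partial_tesler (Suc k) n a"
      by (simp add: partial_tesler_def)
    moreover have "(\<lambda>i. m i (Suc k)) \<in> weak_compositions {1..Suc k} (row_total n a (Suc k) ?m)"
    proof -
      have "m (Suc k) (Suc k) + (\<Sum>i\<in>{1..<Suc k}. m i (Suc k)) = row_total n a (Suc k) ?m"
        using m assms eq[of "Suc k"] by (simp add: partial_tesler_def row_total_def del: sum.op_ivl_Suc)
      moreover have "m i (Suc k) = 0" if "i \<notin> {1..Suc k}" for i
        using m that by (auto simp: partial_tesler_def)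
      ultimately show ?thesis
        unfolding weak_compositions_def mem_Collect_eq split by simp
    qed
    ultimately show "?m \<in> partial_tesler (Suc k) n a \<and>
        (\<lambda>i. m i (Suc k)) \<in> weak_compositions {1..Suc k} (row_total n a (Suc k) ?m)"
      by simp
  qed
qed

lemma finite_partial_tesler:
  assumes "k \<le> n"
  shows "finite (partial_tesler k n a)"
  using assms
proof (induction k rule: inc_induct)
  case base
  then show ?case
    by (simp add: partial_tesler_self)
next
  case (step k)
  then show ?case
    using bij_betw_finite[OF bij_betw_add_column[OF step.hyps(2)]]
    by (auto intro!: finite_SigmaI finite_weak_compositions)
qed

definition tesler_coeff :: "'a::field \<Rightarrow> 'a \<Rightarrow> nat \<Rightarrow> nat \<Rightarrow> nat \<Rightarrow> 'a" where
  "tesler_coeff q t i j = (if j = Suc i then coeff_B q t else coeff_A q t)"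

text \<open>The variable \<open>z i\<close> marks all entries of row \<open>i\<close> in the
  remaining columns, for each row whose own column has been summed out.\<close>

definition partial_tesler_sum ::
    "'a::field \<Rightarrow> 'a \<Rightarrow> (nat \<Rightarrow> nat) \<Rightarrow> nat \<Rightarrow> nat \<Rightarrow> (nat \<Rightarrow> 'a) \<Rightarrow> 'a" where
  "partial_tesler_sum q t a n k z = (\<Sum>m\<in>partial_tesler k n a.
     \<Prod>j\<in>{k<..n}. (\<Prod>i\<in>{1..<j}. tesler_coeff q t i j (m i j)) * (\<Prod>i\<in>{1..k}. z i ^ m i j))"

text \<open>Generating function of one column by its total. The all-ones series is 1/(1-x), for the
  diagonal entry, which has weight 1. Row \<open>k\<close> is superdiagonal and gives B; the rows
  before it give A.\<close>

definition column_series :: "'a::field \<Rightarrow> 'a \<Rightarrow> nat \<Rightarrow> (nat \<Rightarrow> 'a) \<Rightarrow> 'a fps" where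
  "column_series q t k z =
     Abs_fps (\<lambda>_. 1) * (\<Prod>i\<in>{1..k}. Abs_fps (\<lambda>e. tesler_coeff q t i (Suc k) e * z i ^ e))"

lemma partial_tesler_sum_self [simp]: "partial_tesler_sum q t a n n z = 1"
  by (simp add: partial_tesler_sum_def partial_tesler_self)

lemma fps_nth_column_series:
  "fps_nth (column_series q t k z) p = (\<Sum>e\<in>weak_compositions {1..Suc k} p.
     \<Prod>i\<in>{1..k}. tesler_coeff q t i (Suc k) (e i) * z i ^ e i)"
proof -
  define f where "f i = (if i = Suc k then Abs_fps (\<lambda>_. 1) else
    Abs_fps (\<lambda>e. tesler_coeff q t i (Suc k) e * z i ^ e))" for i
  have ins: "{1..Suc k} = insert (Suc k) {1..k}"
    by auto
  have "column_series q t k z = (\<Prod>i\<in>{1..Suc k}. f i)"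
    unfolding ins column_series_def by (simp add: f_def)
  moreover have "(\<Prod>i\<in>{1..Suc k}. fps_nth (f i) (e i)) =
      (\<Prod>i\<in>{1..k}. tesler_coeff q t i (Suc k) (e i) * z i ^ e i)" for e
    unfolding ins by (simp add: f_def)
  ultimately show ?thesis
    by (simp add: fps_nth_prod_eq del: prod.cl_ivl_Suc)
qed

text \<open>The later columns fix the total of column \<open>Suc k\<close>; summing over its
  compositions is taking one coefficient of a product of series.\<close>

lemma partial_tesler_sum_step:
  assumes "k < n"
  shows "partial_tesler_sum q t a n k z = (\<Sum>m\<in>partial_tesler (Suc k) n a.
     (\<Prod>j\<in>{Suc k<..n}. (\<Prod>i\<in>{1..<j}. tesler_coeff q t i j (m i j)) * (\<Prod>i\<in>{1..k}. z i ^ m i j)) *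
     fps_nth (column_series q t k z) (row_total n a (Suc k) m))"
proof -
  let ?W = "\<lambda>m. weak_compositions {1..Suc k} (row_total n a (Suc k) m)"
  let ?D = "SIGMA m:partial_tesler (Suc k) n a. ?W m"
  let ?f = "\<lambda>j m. (\<Prod>i\<in>{1..<j}. tesler_coeff q t i j (m i j)) * (\<Prod>i\<in>{1..k}. z i ^ m i j)"
  let ?g = "\<lambda>e. \<Prod>i\<in>{1..k}. tesler_coeff q t i (Suc k) (e i) * z i ^ e i"
  have cols: "{k<..n} = insert (Suc k) {Suc k<..n}"
    using assms by auto
  have "(\<Prod>j\<in>{k<..n}. ?f j (add_column (Suc k) e m)) = (\<Prod>j\<in>{Suc k<..n}. ?f j m) * ?g e" for m e
  proof -
    have "(\<Prod>j\<in>{Suc k<..n}. ?f j (add_column (Suc k) e m)) = (\<Prod>j\<in>{Suc k<..n}. ?f j m)"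
      by (intro prod.cong) (auto simp: add_column_def)
    moreover have "?f (Suc k) (add_column (Suc k) e m) = ?g e"
      by (simp add: add_column_def prod.distrib atLeastLessThanSuc_atLeastAtMost)
    ultimately show ?thesis
      unfolding cols by (simp add: mult.commute)
  qed
  then have "partial_tesler_sum q t a n k z =
      (\<Sum>(m, e)\<in>?D. (\<Prod>j\<in>{Suc k<..n}. ?f j m) * ?g e)"
    unfolding partial_tesler_sum_def
    by (subst sum.reindex_bij_betw[OF bij_betw_add_column[OF assms], symmetric])
      (simp add: case_prod_unfold)
  also have "\<dots> = (\<Sum>m\<in>partial_tesler (Suc k) n a. \<Sum>e\<in>?W m. (\<Prod>j\<in>{Suc k<..n}. ?f j m) * ?g e)"
    using assms by (intro sum.Sigma[symmetric]) (auto intro: finite_partial_tesler finite_weak_compositions)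
  finally show ?thesis
    by (simp add: fps_nth_column_series sum_distrib_left)
qed

text \<open>The base of the induction, at \<open>k = 1\<close> with the monomial 1 of box (1,
  1).\<close>

lemma partial_tesler_sum_one:
  assumes "n \<ge> 1"
  shows "partial_tesler_sum q t a n 1 (\<lambda>_. 1) = (\<Sum>m\<in>tesler_matrices n a.
     (\<Prod>i\<in>{1..n-1}. coeff_B q t (m i (i + 1))) *
     (\<Prod>(i, j)\<in>{(i, j). 1 \<le> i \<and> i + 1 < j \<and> j \<le> n}. coeff_A q t (m i j)))"
proof -
  have factor: "(\<Prod>j\<in>{0<..n}. \<Prod>i\<in>{1..<j}. tesler_coeff q t i j (m i j)) =
     (\<Prod>i\<in>{1..n-1}. coeff_B q t (m i (i + 1))) *
     (\<Prod>(i, j)\<in>{(i, j). 1 \<le> i \<and> i + 1 < j \<and> j \<le> n}. coeff_A q t (m i j))" for m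
  proof -
    let ?A = "{(i, j). 1 \<le> i \<and> i + 1 < j \<and> j \<le> n}"
    let ?B = "(\<lambda>i. (i, Suc i)) ` {1..n-1}"
    have "(\<Prod>j\<in>{0<..n}. \<Prod>i\<in>{1..<j}. tesler_coeff q t i j (m i j)) =
        (\<Prod>(j, i)\<in>(SIGMA j:{0<..n}. {1..<j}). tesler_coeff q t i j (m i j))"
      by (rule prod.Sigma) auto
    also have "\<dots> = (\<Prod>(i, j)\<in>?B \<union> ?A. tesler_coeff q t i j (m i j))"
      by (rule prod.reindex_bij_witness[where i = prod.swap and j = prod.swap])
        (use assms in \<open>auto simp: image_iff\<close>)
    also have "\<dots> = (\<Prod>(i, j)\<in>?B. tesler_coeff q t i j (m i j)) *
        (\<Prod>(i, j)\<in>?A. tesler_coeff q t i j (m i j))"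
    proof (rule prod.union_disjoint)
      show "finite ?A"
        by (rule finite_subset[of _ "{..n} \<times> {..n}"]) auto
    qed auto
    also have "(\<Prod>(i, j)\<in>?A. tesler_coeff q t i j (m i j)) = (\<Prod>(i, j)\<in>?A. coeff_A q t (m i j))"
      by (rule prod.cong) (auto simp: tesler_coeff_def)
    also have "(\<Prod>(i, j)\<in>?B. tesler_coeff q t i j (m i j)) = (\<Prod>i\<in>{1..n-1}. coeff_B q t (m i (i + 1)))"
      by (subst prod.reindex) (auto simp: inj_on_def tesler_coeff_def)
    finally show ?thesis .
  qed
  \<comment> \<open>Column 1 consists of the diagonal entry alone: its value is forced, and its
    series 1/(1-x) has all coefficients 1. Row 1 thus receives the variable 1.\<close>
  have "partial_tesler_sum q t a n 0 (\<lambda>_. 1) = partial_tesler_sum q t a n 1 (\<lambda>_. 1)"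
  proof -
    have "fps_nth (column_series q t 0 z) p = 1" for z p
      by (simp add: column_series_def)
    then show ?thesis
      using partial_tesler_sum_step[of 0 n q t a "\<lambda>_. 1"] assms
      by (simp add: partial_tesler_sum_def)
  qed
  then show ?thesis
    unfolding tesler_matrices_eq factor[symmetric] by (simp add: partial_tesler_sum_def)
qed

subsection \<open>Summing over one column\<close>

lemma linear_series_nonzero [simp]:
  fixes c :: "'a::field"
  shows "1 - fps_const c * fps_X \<noteq> (0 :: 'a fps)"
proof
  assume "1 - fps_const c * fps_X = (0 :: 'a fps)"
  from arg_cong[OF this, of "\<lambda>f. fps_nth f 0"] show False
    by simp
qed

text \<open>The substitution of z x for x respects multiplication by a linear factor. It carries the
  defining equations of A and B over to their rescaled versions.\<close>

lemma linear_series_mult_Abs_fps: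
  fixes c :: "'a::field"
  shows "(1 - fps_const (c * z) * fps_X) * Abs_fps (\<lambda>e. fps_nth f e * z ^ e) =
    Abs_fps (\<lambda>e. fps_nth ((1 - fps_const c * fps_X) * f) e * z ^ e)"
proof (rule fps_ext)
  fix e
  show "fps_nth ((1 - fps_const (c * z) * fps_X) * Abs_fps (\<lambda>e. fps_nth f e * z ^ e)) e =
    fps_nth (Abs_fps (\<lambda>e. fps_nth ((1 - fps_const c * fps_X) * f) e * z ^ e)) e"
    unfolding fps_nth_linear_factor_mult fps_nth_Abs_fps by (cases e) (simp_all add: algebra_simps)
qed

lemma fps_divide_mult_cancel:
  fixes f g :: "'a::field fps"
  assumes "fps_nth g 0 \<noteq> 0"
  shows "f / g * g = f"
  using assms by (simp add: fps_divide_unit mult.assoc inverse_mult_eq_1)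

lemma coeff_B_series:
  fixes q t z :: "'a::field"
  shows "Abs_fps (\<lambda>e. coeff_B q t e * z ^ e) *
    ((1 - fps_const (q * z) * fps_X) * (1 - fps_const (t * z) * fps_X)) = 1 - fps_const z * fps_X"
proof -
  let ?l = "\<lambda>c::'a. 1 - fps_const c * fps_X"
  define B where "B = (1 - fps_X) / (?l q * ?l t)"
  have "fps_nth (?l q * ?l t) 0 \<noteq> 0"
    by simp
  from fps_divide_mult_cancel[OF this, of "1 - fps_X"] have eq: "?l q * (?l t * B) = 1 - fps_X"
    unfolding B_def by (simp only: mult_ac)
  have "?l (q * z) * (?l (t * z) * Abs_fps (\<lambda>e. fps_nth B e * z ^ e)) =
      Abs_fps (\<lambda>e. fps_nth (1 - fps_X) e * z ^ e)"
    unfolding linear_series_mult_Abs_fps eq ..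
  also have "\<dots> = ?l z"
    by (rule fps_ext) (auto simp: le_Suc_eq)
  finally show ?thesis
    unfolding coeff_B_def B_def[symmetric] by (simp only: mult_ac)
qed

lemma coeff_A_series:
  fixes q t z :: "'a::field"
  shows "Abs_fps (\<lambda>e. coeff_A q t e * z ^ e) *
    ((1 - fps_const (q * z) * fps_X) * (1 - fps_const (t * z) * fps_X)) =
    (1 - fps_const z * fps_X) * (1 - fps_const (q * t * z) * fps_X)"
proof -
  let ?l = "\<lambda>c::'a. 1 - fps_const c * fps_X"
  define A where "A = (1 - fps_X) * (1 - fps_const (q * t) * fps_X) / (?l q * ?l t)"
  have "fps_nth (?l q * ?l t) 0 \<noteq> 0"
    by simp
  from fps_divide_mult_cancel[OF this, of "(1 - fps_X) * ?l (q * t)"]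
  have eq: "?l q * (?l t * A) = ?l (q * t) * (1 - fps_X)"
    unfolding A_def by (simp only: mult_ac)
  have "?l (q * z) * (?l (t * z) * Abs_fps (\<lambda>e. fps_nth A e * z ^ e)) =
      ?l (q * t * z) * Abs_fps (\<lambda>e. fps_nth (1 - fps_X) e * z ^ e)"
    unfolding linear_series_mult_Abs_fps eq ..
  also have "Abs_fps (\<lambda>e. fps_nth (1 - fps_X) e * z ^ e) = ?l z"
    by (rule fps_ext) (auto simp: le_Suc_eq)
  finally show ?thesis
    unfolding coeff_A_def A_def[symmetric] by (simp only: mult_ac)
qed

text \<open>Row \<open>k\<close> contributes B, whose numerator lacks
  \<open>l (q * t * z k)\<close>. Supplying this factor on the left makes the right side uniform in
  \<open>i\<close>, which is the shape needed for the corner identity.\<close>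

lemma column_series_mult:
  fixes q t :: "'a::field"
  assumes "1 \<le> k"
  defines "l \<equiv> \<lambda>c::'a. 1 - fps_const c * fps_X"
  shows "column_series q t k z * (l 1 * (\<Prod>i\<in>{1..k}. l (q * z i) * l (t * z i)) * l (q * t * z k)) =
    (\<Prod>i\<in>{1..k}. l (z i) * l (q * t * z i))"
proof -
  let ?C = "\<lambda>i. Abs_fps (\<lambda>e. tesler_coeff q t i (Suc k) e * z i ^ e)"
  let ?D = "\<lambda>i. l (q * z i) * l (t * z i)"
  have ivl: "{1..k} = insert k {1..<k}"
    using assms(1) by auto
  have ins: "(\<Prod>i\<in>insert k {1..<k}. h i) = h k * (\<Prod>i\<in>{1..<k}. h i)" for h :: "nat \<Rightarrow> 'a fps"
    by simp
  have geo: "Abs_fps (\<lambda>_. 1) * l 1 = 1"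
    using fps_geometric_mult_linear[of "1 :: 'a"] by (simp add: l_def)
  have last: "?C k * ?D k = l (z k)"
    unfolding tesler_coeff_def l_def by (simp only: simp_thms if_True coeff_B_series)
  have others: "(\<Prod>i\<in>{1..<k}. ?C i * ?D i) = (\<Prod>i\<in>{1..<k}. l (z i) * l (q * t * z i))"
    by (rule prod.cong) (simp_all add: tesler_coeff_def l_def coeff_A_series)
  have "column_series q t k z * (l 1 * (\<Prod>i\<in>{1..k}. ?D i) * l (q * t * z k)) =
      (Abs_fps (\<lambda>_. 1) * l 1) * (\<Prod>i\<in>{1..k}. ?C i * ?D i) * l (q * t * z k)"
    unfolding column_series_def prod.distrib by (simp only: mult_ac)
  also have "\<dots> = l (z k) * (\<Prod>i\<in>{1..<k}. l (z i) * l (q * t * z i)) * l (q * t * z k)"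
    unfolding geo ivl ins last others by simp
  also have "\<dots> = (\<Prod>i\<in>{1..k}. l (z i) * l (q * t * z i))"
    unfolding ivl ins by (simp only: mult_ac)
  finally show ?thesis .
qed

lemma partial_tesler_sum_cong:
  assumes "\<And>i. i \<in> {1..k} \<Longrightarrow> z i = z' i"
  shows "partial_tesler_sum q t a n k z = partial_tesler_sum q t a n k z'"
  unfolding partial_tesler_sum_def using assms by (intro sum.cong prod.cong arg_cong2[of _ _ _ _ "(*)"]) auto

text \<open>The exponent is \<open>row_total\<close>, so a power of \<open>w b\<close> splits into
  \<open>w b ^ a (Suc k)\<close> and one factor \<open>w b ^ m (Suc k) j\<close> for each later
  column. The latter are exactly the factors of a new variable with value \<open>w b\<close>, and
  the sum reproduces its own form.\<close>

lemma partial_tesler_sum_expand: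
  fixes w :: "'b \<Rightarrow> 'a::field"
  assumes "k < n"
    and series: "\<And>p. fps_nth (column_series q t k z) p = (\<Sum>b\<in>B. c b * w b ^ p)"
  shows "partial_tesler_sum q t a n k z =
    (\<Sum>b\<in>B. c b * w b ^ a (Suc k) * partial_tesler_sum q t a n (Suc k) (z(Suc k := w b)))"
proof -
  let ?M = "partial_tesler (Suc k) n a"
  let ?g = "\<lambda>m. \<Prod>j\<in>{Suc k<..n}. (\<Prod>i\<in>{1..<j}. tesler_coeff q t i j (m i j)) * (\<Prod>i\<in>{1..k}. z i ^ m i j)"
  have next_sum: "partial_tesler_sum q t a n (Suc k) (z(Suc k := x)) =
      (\<Sum>m\<in>?M. ?g m * x ^ (\<Sum>j\<in>{Suc k<..n}. m (Suc k) j))" for x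
    unfolding partial_tesler_sum_def
  proof (rule sum.cong)
    fix m :: "nat \<Rightarrow> nat \<Rightarrow> nat"
    have "(\<Prod>i\<in>{1..Suc k}. (z(Suc k := x)) i ^ m i j) = (\<Prod>i\<in>{1..k}. z i ^ m i j) * x ^ m (Suc k) j" for j
    proof -
      have "(\<Prod>i\<in>{1..k}. (z(Suc k := x)) i ^ m i j) = (\<Prod>i\<in>{1..k}. z i ^ m i j)"
        by (rule prod.cong) auto
      then show ?thesis
        by (simp add: mult.commute)
    qed
    then show "(\<Prod>j\<in>{Suc k<..n}. (\<Prod>i\<in>{1..<j}. tesler_coeff q t i j (m i j)) *
        (\<Prod>i\<in>{1..Suc k}. (z(Suc k := x)) i ^ m i j)) = ?g m * x ^ (\<Sum>j\<in>{Suc k<..n}. m (Suc k) j)"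
      by (simp only: prod.distrib power_sum mult.assoc)
  qed simp
  have "partial_tesler_sum q t a n k z =
      (\<Sum>m\<in>?M. \<Sum>b\<in>B. c b * w b ^ a (Suc k) * (?g m * w b ^ (\<Sum>j\<in>{Suc k<..n}. m (Suc k) j)))"
    unfolding partial_tesler_sum_step[OF assms(1)] series row_total_def power_add sum_distrib_left
    by (simp only: mult_ac)
  also have "\<dots> = (\<Sum>b\<in>B. c b * w b ^ a (Suc k) *
      partial_tesler_sum q t a n (Suc k) (z(Suc k := w b)))"
    unfolding next_sum sum_distrib_left by (rule sum.swap)
  finally show ?thesis .
qed

section \<open>Box monomials and the partial fractions of a column\<close>

definition box_monomial :: "'a::field \<Rightarrow> 'a \<Rightarrow> nat \<times> nat \<Rightarrow> 'a" where
  "box_monomial q t = (\<lambda>(r, c). q ^ (c - 1) * t ^ (r - 1))"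

lemma inj_on_box_monomial:
  assumes "inj (\<lambda>(i, j). q ^ i * t ^ j)"
  shows "inj_on (box_monomial q t) {(r, c). 0 < r \<and> 0 < c}"
proof (rule inj_onI, clarify)
  fix r c r' c' :: nat
  assume "0 < r" "0 < c" "0 < r'" "0 < c'" "box_monomial q t (r, c) = box_monomial q t (r', c')"
  then show "r = r' \<and> c = c'"
    using injD[OF assms, of "(c - 1, r - 1)" "(c' - 1, r' - 1)"] by (auto simp: box_monomial_def)
qed

lemma box_monomial_nonzero:
  assumes "inj (\<lambda>(i, j). q ^ i * t ^ j)"
  shows "box_monomial q t b \<noteq> 0"
proof -
  \<comment> \<open>If \<open>q\<close> or \<open>t\<close> were 0, its first and second powers
    would coincide.\<close>
  have "q \<noteq> 0" "t \<noteq> 0"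
    using injD[OF assms, of "(1, 0)" "(2, 0)"] injD[OF assms, of "(0, 1)" "(0, 2)"] by auto
  then show ?thesis
    by (simp add: box_monomial_def case_prod_unfold)
qed

text \<open>Moving a box one column right or one row up multiplies its monomial by \<open>q\<close>
  or \<open>t\<close>. The last box is split off from the removable ones because its factor is the
  one supplied by hand in \<open>column_series_mult\<close>.\<close>

lemma growth_prod_corners:
  fixes q t :: "'a::field" and g :: "'a \<Rightarrow> 'b::comm_monoid_mult"
  assumes s: "s \<in> growth k" and k: "1 \<le> k"
  defines "z \<equiv> \<lambda>i. box_monomial q t (s i)" and "S \<equiv> s ` {1..k}"
  shows "(\<Prod>i\<in>{1..k}. g (z i) * g (q * t * z i)) * (\<Prod>b\<in>addable S. g (box_monomial q t b)) =
    g 1 * (\<Prod>i\<in>{1..k}. g (q * z i) * g (t * z i)) *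
    (g (q * t * z k) * (\<Prod>b\<in>removable S - {s k}. g (q * t * box_monomial q t b)))"
proof -
  have S: "finite S" "diagram S" and inj: "inj_on s {1..k}"
    using s by (auto simp: S_def growth_def)
  have pos: "0 < r" "0 < c" if "(r, c) \<in> S" for r c
    using S(2) that unfolding diagram_def by blast+
  have shift: "box_monomial q t (Suc r, Suc c) = q * t * box_monomial q t (r, c)"
    "box_monomial q t (r, Suc c) = q * box_monomial q t (r, c)"
    "box_monomial q t (Suc r, c) = t * box_monomial q t (r, c)" if "(r, c) \<in> S" for r c
    using pos[OF that] by (auto simp: box_monomial_def gr0_conv_Suc)
  have S_prod: "(\<Prod>b\<in>S. h b) = (\<Prod>i\<in>{1..k}. h (s i))" for h :: "nat \<times> nat \<Rightarrow> 'b"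
    unfolding S_def by (rule prod.reindex_cong[OF inj]) auto
  have "(\<Prod>(r, c)\<in>removable S. g (box_monomial q t (Suc r, Suc c))) =
      (\<Prod>b\<in>removable S. g (q * t * box_monomial q t b))"
    by (rule prod.cong) (auto simp: removable_def shift)
  also have "\<dots> = g (q * t * z k) * (\<Prod>b\<in>removable S - {s k}. g (q * t * box_monomial q t b))"
    unfolding z_def using growth_last_removable[OF s k] finite_removable[OF S(1)]
    by (intro prod.remove) (auto simp: S_def)
  finally have rem: "(\<Prod>(r, c)\<in>removable S. g (box_monomial q t (Suc r, Suc c))) =
    g (q * t * z k) * (\<Prod>b\<in>removable S - {s k}. g (q * t * box_monomial q t b))" .
  have "(\<Prod>(r, c)\<in>S. g (box_monomial q t (Suc r, Suc c))) = (\<Prod>i\<in>{1..k}. g (q * t * z i))"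
    unfolding z_def
    by (subst S_prod[of "\<lambda>b. g (q * t * box_monomial q t b)", symmetric]) (auto intro!: prod.cong simp: shift)
  moreover have "(\<Prod>(r, c)\<in>S. g (box_monomial q t (r, Suc c))) = (\<Prod>i\<in>{1..k}. g (q * z i))"
    unfolding z_def
    by (subst S_prod[of "\<lambda>b. g (q * box_monomial q t b)", symmetric]) (auto intro!: prod.cong simp: shift)
  moreover have "(\<Prod>(r, c)\<in>S. g (box_monomial q t (Suc r, c))) = (\<Prod>i\<in>{1..k}. g (t * z i))"
    unfolding z_def
    by (subst S_prod[of "\<lambda>b. g (t * box_monomial q t b)", symmetric]) (auto intro!: prod.cong simp: shift)
  moreover have "(\<Prod>b\<in>S. g (box_monomial q t b)) = (\<Prod>i\<in>{1..k}. g (z i))"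
    unfolding z_def by (rule S_prod)
  moreover have "box_monomial q t (1, 1) = 1"
    by (simp add: box_monomial_def)
  ultimately show ?thesis
    using prod_corners[OF S, of "\<lambda>b. g (box_monomial q t b)"]
    by (simp only: rem prod.distrib mult_ac)
qed

text \<open>The factor by which a tableau weight grows when a box with monomial \<open>w\<close> is
  added to \<open>k\<close> boxes with monomials \<open>z\<close>.\<close>

definition step_weight :: "'a::field \<Rightarrow> 'a \<Rightarrow> nat \<Rightarrow> (nat \<Rightarrow> 'a) \<Rightarrow> 'a \<Rightarrow> 'a" where
  "step_weight q t k z w =
     1 / (omit0 (1 - inverse w) * omit0 (1 - q * t * z k / w)) *
     (\<Prod>i\<in>{1..k}. (omit0 (1 - z i / w) * omit0 (1 - q * t * z i / w)) /
        (omit0 (1 - q * z i / w) * omit0 (1 - t * z i / w)))"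

lemma omit0_nonzero [simp]: "omit0 x \<noteq> 0"
  by (simp add: omit0_def)

lemma column_series_growth:
  fixes q t :: "'a::field"
  assumes inj: "inj (\<lambda>(i, j). q ^ i * t ^ j)" and s: "s \<in> growth k" and k: "1 \<le> k"
  defines "z \<equiv> \<lambda>i. box_monomial q t (s i)"
  shows "fps_nth (column_series q t k z) p = (\<Sum>b\<in>addable (s ` {1..k}).
    step_weight q t k z (box_monomial q t b) * box_monomial q t b ^ p)"
proof -
  define S where "S = s ` {1..k}"
  have S: "finite S" "diagram S"
    using s by (auto simp: S_def growth_def)
  have posS: "0 < r \<and> 0 < c" if "(r, c) \<in> S" for r c
    using S(2) that unfolding diagram_def by blast
  let ?w = "box_monomial q t"
  let ?R = "removable S - {s k}"
  define N where "N = (\<Prod>b\<in>?R. [:1, - (q * t * ?w b):])"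
  let ?l = "\<lambda>c::'a. 1 - fps_const c * fps_X"
  note nonzero = box_monomial_nonzero[OF inj]
  have inj_w: "inj_on ?w (addable S)"
    by (rule inj_on_subset[OF inj_on_box_monomial[OF inj]]) (auto simp: addable_def)
  have "degree N < card (addable S)"
  proof -
    have "degree N \<le> (\<Sum>b\<in>?R. degree [:1, - (q * t * ?w b):])"
      unfolding N_def using finite_removable[OF S(1)]
      by (intro degree_prod_sum_le[unfolded o_def]) simp
    also have "\<dots> \<le> (\<Sum>b\<in>?R. 1)"
      by (intro sum_mono) simp
    also have "\<dots> \<le> card (removable S)"
      using finite_removable[OF S(1)] by (simp add: card_mono)
    finally show ?thesis
      unfolding card_addable[OF S] by simp
  qed
  moreover have "column_series q t k z * (\<Prod>b\<in>addable S. ?l (?w b)) = fps_of_poly N"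
  proof -
    \<comment> \<open>\<open>?D\<close> is both the multiplier in \<open>column_series_mult\<close>
      and, apart from the factors in \<open>N\<close>, the right side of the corner identity. It
      cancels since power series over a field form a domain.\<close>
    let ?D = "?l 1 * (\<Prod>i\<in>{1..k}. ?l (q * z i) * ?l (t * z i)) * ?l (q * t * z k)"
    have N: "fps_of_poly N = (\<Prod>b\<in>?R. ?l (q * t * ?w b))"
      unfolding N_def fps_of_poly_prod fps_of_poly_linear ..
    have "column_series q t k z * (\<Prod>b\<in>addable S. ?l (?w b)) * ?D =
        (column_series q t k z * ?D) * (\<Prod>b\<in>addable S. ?l (?w b))"
      by (simp only: mult_ac)
    also have "\<dots> = (\<Prod>i\<in>{1..k}. ?l (z i) * ?l (q * t * z i)) * (\<Prod>b\<in>addable S. ?l (?w b))"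
      unfolding column_series_mult[OF k] ..
    also have "\<dots> = ?l 1 * (\<Prod>i\<in>{1..k}. ?l (q * z i) * ?l (t * z i)) * (?l (q * t * z k) * fps_of_poly N)"
      unfolding N z_def S_def by (rule growth_prod_corners[OF s k])
    also have "\<dots> = fps_of_poly N * ?D"
      by (simp only: mult_ac)
    finally have "column_series q t k z * (\<Prod>b\<in>addable S. ?l (?w b)) * ?D = fps_of_poly N * ?D" .
    moreover have "?D \<noteq> 0"
      by (simp only: mult_eq_0_iff prod_zero_iff finite_atLeastAtMost linear_series_nonzero) simp
    ultimately show ?thesis
      using mult_right_cancel by blast
  qed
  ultimately have "fps_nth (column_series q t k z) p = (\<Sum>b\<in>addable S.
      poly N (inverse (?w b)) / (\<Prod>b'\<in>addable S - {b}. 1 - ?w b' / ?w b) * ?w b ^ p)"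
    using nonzero by (intro fps_partial_fractions finite_addable S inj_w)
  also have "\<dots> = (\<Sum>b\<in>addable S. step_weight q t k z (?w b) * ?w b ^ p)"
  proof (rule sum.cong)
    fix b assume b: "b \<in> addable S"
    let ?g = "\<lambda>x. omit0 (1 - x / ?w b)"
    have add: "(\<Prod>b'\<in>addable S. ?g (?w b')) = (\<Prod>b'\<in>addable S - {b}. 1 - ?w b' / ?w b)" (is "_ = ?P")
    proof -
      \<comment> \<open>Distinct addable boxes have distinct monomials, so the only vanishing factor
        is that of \<open>b\<close> itself. Its omission turns the full product into the punctured
        one of the partial fraction formula.\<close>
      have "?g (?w b') = 1 - ?w b' / ?w b" if "b' \<in> addable S - {b}" for b'
        using that b inj_w nonzero by (auto simp: omit0_def inj_on_def)
      then have "?P = (\<Prod>b'\<in>addable S - {b}. ?g (?w b'))"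
        by (intro prod.cong) auto
      moreover have "?g (?w b) = 1"
        using nonzero by (simp add: omit0_def)
      ultimately show ?thesis
        using b finite_addable[OF S(1)] by (simp add: prod.remove)
    qed
    have "?P \<noteq> 0"
      unfolding add[symmetric] using finite_addable[OF S(1)] by simp
    have rem: "(\<Prod>b'\<in>?R. ?g (q * t * ?w b')) = poly N (inverse (?w b))"
    proof -
      \<comment> \<open>The diagonal shift (r+1, c+1) of a removable box is never addable, because
        its left neighbour (r+1, c) is not in \<open>S\<close>. Hence no zero of \<open>N\<close>
        meets a pole and \<open>omit0\<close> changes nothing here.\<close>
      have "1 - q * t * ?w b' / ?w b \<noteq> 0" if "b' \<in> ?R" for b'
      proof -
        obtain r c where rc: "b' = (r, c)"
          by fastforce
        have mem: "(r, c) \<in> S" "(Suc r, c) \<notin> S"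
          using that by (auto simp: rc removable_def)
        then have "q * t * ?w b' = ?w (Suc r, Suc c)"
          using posS[of r c] by (auto simp: box_monomial_def rc gr0_conv_Suc)
        moreover have "(Suc r, Suc c) \<noteq> b" "0 < fst b" "0 < snd b"
          using b mem posS[of r c] by (auto simp: addable_def)
        then have "?w (Suc r, Suc c) \<noteq> ?w b"
          using inj_on_contraD[OF inj_on_box_monomial[OF inj], of "(Suc r, Suc c)" b]
          by (auto simp: case_prod_unfold)
        ultimately show ?thesis
          using nonzero by simp
      qed
      then show ?thesis
        unfolding N_def poly_prod by (intro prod.cong) (auto simp: omit0_def divide_inverse mult_ac)
    qed
    \<comment> \<open>The same corner identity, now with field values: each linear factor is
      evaluated at the inverse of \<open>?w b\<close> and replaced by 1 if it vanishes.\<close>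
    have "(\<Prod>i\<in>{1..k}. ?g (z i) * ?g (q * t * z i)) * ?P =
        ?g 1 * (\<Prod>i\<in>{1..k}. ?g (q * z i) * ?g (t * z i)) * (?g (q * t * z k) * poly N (inverse (?w b)))"
      unfolding add[symmetric] rem[symmetric]
      using growth_prod_corners[OF s k, of ?g q t] unfolding z_def S_def .
    moreover have "(\<Prod>i\<in>{1..k}. ?g (q * z i) * ?g (t * z i)) \<noteq> 0"
      by simp
    ultimately have "step_weight q t k z (?w b) = poly N (inverse (?w b)) / ?P"
      using \<open>?P \<noteq> 0\<close> unfolding step_weight_def prod_dividef
      by (simp add: field_simps)
    then show "poly N (inverse (?w b)) / ?P * ?w b ^ p = step_weight q t k z (?w b) * ?w b ^ p"
      by simp
  qed simp
  finally show ?thesis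
    unfolding S_def .
qed

section \<open>Tableau weights along growth sequences, and the induction\<close>

definition seq_weight :: "'a::field \<Rightarrow> 'a \<Rightarrow> nat \<Rightarrow> (nat \<Rightarrow> 'a) \<Rightarrow> 'a" where
  "seq_weight q t n z =
     (\<Prod>i=2..n. 1 / (omit0 (1 - inverse (z i)) * omit0 (1 - q * t * z (i - 1) / z i))) *
     (\<Prod>(i, j)\<in>{(i, j). 1 \<le> i \<and> i < j \<and> j \<le> n}.
        (omit0 (1 - z i / z j) * omit0 (1 - q * t * z i / z j)) /
        (omit0 (1 - q * z i / z j) * omit0 (1 - t * z i / z j)))"

lemma seq_weight_cong:
  assumes "\<And>i. i \<in> {1..n} \<Longrightarrow> z i = z' i"
  shows "seq_weight q t n z = seq_weight q t n z'"
  unfolding seq_weight_def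
proof (intro arg_cong2[of _ _ _ _ "(*)"] prod.cong refl, goal_cases)
  case (1 i)
  then have "z i = z' i" "z (i - 1) = z' (i - 1)"
    by (auto intro!: assms)
  then show ?case
    by simp
next
  case (2 x)
  then show ?case
    using assms[of "fst x"] assms[of "snd x"] by auto
qed

lemma seq_weight_1: "seq_weight q t 1 z = 1"
proof -
  have "{(i, j). 1 \<le> i \<and> i < j \<and> j \<le> (1 :: nat)} = {}"
    by auto
  then show ?thesis
    unfolding seq_weight_def by (simp only:) simp
qed

text \<open>The new factors are the single-index one at \<open>Suc k\<close> and those of the pairs
  \<open>(i, Suc k)\<close>. The earlier ones never involve the new monomial.\<close>

lemma seq_weight_Suc:
  assumes "1 \<le> k"
  shows "seq_weight q t (Suc k) z = seq_weight q t k z * step_weight q t k z (z (Suc k))"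
proof -
  let ?f = "\<lambda>i j. (omit0 (1 - z i / z j) * omit0 (1 - q * t * z i / z j)) /
        (omit0 (1 - q * z i / z j) * omit0 (1 - t * z i / z j))"
  let ?P = "\<lambda>n::nat. {(i, j). 1 \<le> i \<and> i < j \<and> j \<le> n}"
  have "?P (Suc k) = ?P k \<union> (\<lambda>i. (i, Suc k)) ` {1..k}"
    by auto
  then have "(\<Prod>(i, j)\<in>?P (Suc k). ?f i j) = (\<Prod>(i, j)\<in>?P k \<union> (\<lambda>i. (i, Suc k)) ` {1..k}. ?f i j)"
    by (simp only:)
  also have "\<dots> = (\<Prod>(i, j)\<in>?P k. ?f i j) * (\<Prod>(i, j)\<in>(\<lambda>i. (i, Suc k)) ` {1..k}. ?f i j)"
  proof (rule prod.union_disjoint)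
    show "finite (?P k)"
      by (rule finite_subset[of _ "{..k} \<times> {..k}"]) auto
  qed auto
  also have "(\<Prod>(i, j)\<in>(\<lambda>i. (i, Suc k)) ` {1..k}. ?f i j) = (\<Prod>i\<in>{1..k}. ?f i (Suc k))"
    by (subst prod.reindex) (auto simp: inj_on_def)
  finally have pairs: "(\<Prod>(i, j)\<in>?P (Suc k). ?f i j) = (\<Prod>(i, j)\<in>?P k. ?f i j) * (\<Prod>i\<in>{1..k}. ?f i (Suc k))" .
  have "{2..Suc k} = insert (Suc k) {2..k}"
    using assms by auto
  then have "(\<Prod>i=2..Suc k. h i) = (\<Prod>i=2..k. h i) * h (Suc k)" for h :: "nat \<Rightarrow> 'a"
    by (simp add: mult.commute)
  then show ?thesis
    unfolding seq_weight_def step_weight_def pairs by (simp only: diff_Suc_1 mult_ac)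
qed

lemma tableau_sum_eq_growth_sum:
  "tableau_sum q t n a = (\<Sum>s\<in>growth n.
     (\<Prod>i=2..n. box_monomial q t (s i) ^ a i) * seq_weight q t n (\<lambda>i. box_monomial q t (s i)))"
proof -
  have "(\<Prod>i=2..n. box_weight q t T i ^ a i) * tableau_weight q t n T =
      (\<Prod>i=2..n. box_monomial q t (growth_of n T i) ^ a i) *
      seq_weight q t n (\<lambda>i. box_monomial q t (growth_of n T i))" for T
  proof -
    have eq: "box_weight q t T i = box_monomial q t (growth_of n T i)" if "i \<in> {1..n}" for i
      using that by (simp add: box_weight_def box_monomial_def growth_of_def case_prod_unfold)
    have "tableau_weight q t n T = seq_weight q t n (box_weight q t T)"
      by (simp add: tableau_weight_def seq_weight_def Let_def)
    also have "\<dots> = seq_weight q t n (\<lambda>i. box_monomial q t (growth_of n T i))"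
      using eq by (rule seq_weight_cong)
    finally show ?thesis
      using eq by simp
  qed
  then show ?thesis
    unfolding tableau_sum_def by (simp only: sum.reindex_bij_betw[OF bij_betw_growth_of, symmetric])
qed

text \<open>The identity interpolates between the two sides of the theorem: at \<open>k = 1\<close>
  it is trivial, and at \<open>k = n\<close> no column remains and the right side is the sum over
  tableaux.\<close>

lemma partial_tesler_sum_eq_growth_sum:
  fixes q t :: "'a::field"
  assumes inj: "inj (\<lambda>(i, j). q ^ i * t ^ j)" and k: "1 \<le> k" "k \<le> n"
  shows "partial_tesler_sum q t a n 1 (\<lambda>_. 1) = (\<Sum>s\<in>growth k.
     (\<Prod>i=2..k. box_monomial q t (s i) ^ a i) * seq_weight q t k (\<lambda>i. box_monomial q t (s i)) *
     partial_tesler_sum q t a n k (\<lambda>i. box_monomial q t (s i)))"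
  using k
proof (induction k rule: dec_induct)
  case base
  have "partial_tesler_sum q t a n 1 (\<lambda>_. 1) =
      partial_tesler_sum q t a n 1 (\<lambda>i. box_monomial q t (restrict (\<lambda>_. (1, 1)) {1} i))"
    by (rule partial_tesler_sum_cong) (simp add: box_monomial_def)
  then show ?case
    unfolding growth_1 by (simp add: seq_weight_1[simplified])
next
  case (step k)
  let ?w = "box_monomial q t"
  let ?F = "\<lambda>k s. (\<Prod>i=2..k. ?w (s i) ^ a i) * seq_weight q t k (\<lambda>i. ?w (s i)) *
     partial_tesler_sum q t a n k (\<lambda>i. ?w (s i))"
  \<comment> \<open>One summand for \<open>k\<close> boxes is replaced by the summands of all its
    one-box extensions; the partial fraction coefficient of \<open>b\<close> is the
    \<open>step_weight\<close> needed to extend \<open>seq_weight\<close>.\<close>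
  have extend: "?F k s = (\<Sum>b\<in>addable (s ` {1..k}). ?F (Suc k) (s(Suc k := b)))" if s: "s \<in> growth k" for s
  proof -
    let ?z = "\<lambda>i. ?w (s i)"
    let ?c = "\<lambda>b. step_weight q t k ?z (?w b)"
    have "?F (Suc k) (s(Suc k := b)) = (\<Prod>i=2..k. ?z i ^ a i) * seq_weight q t k ?z *
        (?c b * ?w b ^ a (Suc k) * partial_tesler_sum q t a n (Suc k) (?z(Suc k := ?w b)))" for b
    proof -
      have z: "(\<lambda>i. ?w ((s(Suc k := b)) i)) = ?z(Suc k := ?w b)"
        by auto
      have ivl: "{2..Suc k} = insert (Suc k) {2..k}"
        using step.hyps by auto
      have pow: "(\<Prod>i=2..Suc k. ?w ((s(Suc k := b)) i) ^ a i) = ?w b ^ a (Suc k) * (\<Prod>i=2..k. ?z i ^ a i)"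
        unfolding ivl by simp
      have sw: "seq_weight q t k (?z(Suc k := ?w b)) = seq_weight q t k ?z"
        by (rule seq_weight_cong) simp
      have st: "step_weight q t k (?z(Suc k := ?w b)) x = step_weight q t k ?z x" for x
        unfolding step_weight_def by (intro arg_cong2[of _ _ _ _ "(*)"] prod.cong) auto
      show ?thesis
        unfolding z pow seq_weight_Suc[OF step.hyps(1)] sw st by (simp only: fun_upd_same mult_ac)
    qed
    moreover have "partial_tesler_sum q t a n k ?z =
        (\<Sum>b\<in>addable (s ` {1..k}). ?c b * ?w b ^ a (Suc k) *
           partial_tesler_sum q t a n (Suc k) (?z(Suc k := ?w b)))"
      using step.hyps step.prems column_series_growth[OF inj s]
      by (intro partial_tesler_sum_expand) auto
    ultimately show ?thesis
      by (simp add: sum_distrib_left)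
  qed
  have "partial_tesler_sum q t a n 1 (\<lambda>_. 1) = (\<Sum>s\<in>growth k. ?F k s)"
    using step by simp
  also have "\<dots> = (\<Sum>s\<in>growth k. \<Sum>b\<in>addable (s ` {1..k}). ?F (Suc k) (s(Suc k := b)))"
    by (rule sum.cong[OF refl extend])
  also have "\<dots> = (\<Sum>(s, b)\<in>(SIGMA s:growth k. addable (s ` {1..k})). ?F (Suc k) (s(Suc k := b)))"
    by (rule sum.Sigma) (auto intro: finite_growth finite_addable)
  also have "\<dots> = (\<Sum>s\<in>growth (Suc k). ?F (Suc k) s)"
    unfolding case_prod_unfold
    by (rule sum.reindex_bij_betw[OF bij_betw_growth_Suc[unfolded case_prod_unfold]])
  finally show ?case .
qed

theorem tableau_sum_eq_tesler_sum:
  fixes q t :: "'a::field"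
  assumes "inj (\<lambda>(i, j). q ^ i * t ^ j)" "n \<ge> 1"
  shows "tableau_sum q t n a = (\<Sum>m\<in>tesler_matrices n a.
     (\<Prod>i\<in>{1..n-1}. coeff_B q t (m i (i + 1))) *
     (\<Prod>(i, j)\<in>{(i, j). 1 \<le> i \<and> i + 1 < j \<and> j \<le> n}. coeff_A q t (m i j)))"
  using partial_tesler_sum_eq_growth_sum[OF assms order.refl, of a]
  unfolding partial_tesler_sum_one[OF assms(2)] by (simp add: tableau_sum_eq_growth_sum)

text \<open>Each product is the image of \<open>monom (monom 1 i) j\<close>, with the exponent of
  \<open>t_var\<close> outside and that of \<open>q_var\<close> in the coefficient, and embedding
  polynomials into fractions is injective.\<close>

lemma inj_monomials: "inj (\<lambda>(i, j). q_var ^ i * t_var ^ j)"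
proof (rule injI, clarify)
  fix i j i' j' :: nat
  have monom: "q_var ^ i * t_var ^ j = to_fract (monom (monom 1 i) j)" for i j
  proof -
    have pow: "to_fract p ^ l = to_fract (p ^ l)" for p :: "rat poly poly" and l
      by (induction l) simp_all
    have inner: "[:[:0, 1:]:] ^ i = [:monom (1 :: rat) i:]" for i
      by (induction i) (simp_all add: monom_Suc)
    have outer: "[:0, 1:] ^ j = (monom 1 j :: rat poly poly)" for j
      by (induction j) (simp_all add: monom_Suc)
    show ?thesis
      unfolding q_var_def t_var_def pow inner outer to_fract_mult[symmetric] by (simp add: smult_monom)
  qed
  assume "q_var ^ i * t_var ^ j = q_var ^ i' * t_var ^ j'"
  then have "monom (monom (1 :: rat) i) j = monom (monom 1 i') j'"
    unfolding monom by simp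
  then show "i = i' \<and> j = j'"
    by (auto simp: monom_eq_iff')
qed

theorem theorem2p9:
  fixes n :: nat and a :: "nat \<Rightarrow> nat"
  assumes "n \<ge> 1"
  shows "tableau_sum q_var t_var n a =
    (\<Sum>m\<in>tesler_matrices n a.
       (\<Prod>i\<in>{1..n-1}. coeff_B q_var t_var (m i (i + 1))) *
       (\<Prod>(i, j)\<in>{(i, j). 1 \<le> i \<and> i + 1 < j \<and> j \<le> n}. coeff_A q_var t_var (m i j)))"
  using inj_monomials assms by (rule tableau_sum_eq_tesler_sum)

end
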